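(* Let $$I_1=(1,2],\quad I_2=\left(\tfrac12(1+\sqrt{13}),\,1+\sqrt2\right],\quad I_3=(1+\sqrt2,\,3),\quad I_4=[3,\infty)$$ be intervals. For every $i\in\{1,2,3,4\}$ there is a set of requests $\sigma$ (an instance of open, non-preemptive online Dial-a-Ride on the line) such that, for all $\Theta\in I_i$, the algorithm $\textsc{Smartstart}$ with parameter $\Theta$ satisfies $$\frac{\textsc{Smartstart}(\sigma)}{\textsc{Opt}(\sigma)}>\rho^*\approx 2.93768,$$ where $\rho^*:=\frac{2\Theta^{*2}+2\Theta^*}{\Theta^{*2}+\Theta^*-2}$ and $\Theta^*$ is the only positive real solution of $\Theta^*+1-\frac{\Theta^*-1}{3\Theta^*+3}=\frac{2\Theta^{*2}+2\Theta^*}{\Theta^{*2}+\Theta^*-2}$.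
   Context: Open, non-preemptive Dial-a-Ride on the real line. An instance is a finite nonempty set of requests $\sigma=\{\sigma_1,\dots,\sigma_n\}$ with $\sigma_i=(a_i,b_i;r_i)$, $a_i,b_i\in\mathbb{R}$, $r_i\ge 0$: request $\sigma_i$ appears at time $r_i$ at position $a_i$ and must be transported to position $b_i$. A single server of capacity $c\in\mathbb{N}\cup\{\infty\}$ (arbitrary but fixed) starts at the origin at time $0$, moves with unit speed (it may also wait), cannot pick up a request before its release time, never carries more than $c$ requests at once, and a request that was picked up stays on board until it is delivered at its destination (non-preemptive). In the open version the server need not return to the origin. The length of a schedule is the time from its start until its last request is delivered (waiting included). $L(t,p,R)$ is the length of a shortest schedule that starts at position $p$ at time $t$ and serves all requests in $R\subseteq\sigma$ respecting release times. The offline optimum is $\textsc{Opt}(\sigma):=L(0,0,\sigma)$. In the online problem, $\sigma_i$ is revealed only at time $r_i$, and the number of requests is not known in advance. Algorithm $\textsc{Smartstart}$ with parameter $\Theta>1$: let $R_t$ be the set of requests with release time at most $t$ that have not been served by time $t$. Starting at position $p_1=0$ at time $0$, for $j=1,2,\dots$: whenever the server is idle at position $p_j$ at current time $t$, it waits until there are unserved released requests and then until the earliest time $t_j:=\min\{t'\ge t: R_{t'}\ne\emptyset,\ t'\ge L(t',p_j,R_{t'})/(\Theta-1)\}$. At time $t_j$ it starts a shortest schedule $S_j$ serving $R_{t_j}$ from $p_j$, and executes it while ignoring all newly appearing requests; it ends at position $p_{j+1}$, the position where the last request of $S_j$ is delivered. $\textsc{Smartstart}(\sigma)$ denotes the time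 at which all requests of $\sigma$ have been served; it depends on $\Theta$. *)

theory Defs
  imports "HOL-Analysis.Analysis" "HOL-Library.Extended_Nat"
begin

section \<open>Dial-a-Ride on the real line\<close>

datatype request = Request (src: real) (dst: real) (rel: real)

definition dial_a_ride_instance :: "request set \<Rightarrow> bool" where
  "dial_a_ride_instance \<sigma> \<longleftrightarrow> finite \<sigma> \<and> \<sigma> \<noteq> {} \<and> (\<forall>q\<in>\<sigma>. 0 \<le> rel q)"

text \<open>
  A schedule is the trajectory of the server together with the pickup and delivery times of the
  requests.
\<close>

record schedule =
  traj :: "real \<Rightarrow> real"
  pickup :: "request \<Rightarrow> real"
  deliver :: "request \<Rightarrow> real"

text \<open>
  Unit speed with waiting permitted is rendered as a 1-Lipschitz trajectory. A request is on board
  during the half-open interval from its pickup to its delivery, so one request may be delivered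
  and another one picked up at the same instant and place without the two loads adding up. There is
  exactly one such interval for every request, which is non-preemption.
\<close>

definition feasible_schedule ::
    "enat \<Rightarrow> real \<Rightarrow> real \<Rightarrow> request set \<Rightarrow> schedule \<Rightarrow> bool" where
  "feasible_schedule c t p R S \<longleftrightarrow>
     traj S t = p \<and> 1-lipschitz_on {t..} (traj S) \<and>
     (\<forall>q\<in>R. t \<le> pickup S q \<and> rel q \<le> pickup S q \<and> pickup S q \<le> deliver S q \<and>
             traj S (pickup S q) = src q \<and> traj S (deliver S q) = dst q) \<and>
     (\<forall>s\<ge>t. enat (card {q\<in>R. pickup S q \<le> s \<and> s < deliver S q}) \<le> c)"

text \<open>The time from the start \<open>t\<close> until the last delivery (open version, waiting included).\<close>

definition schedule_length :: "real \<Rightarrow> request set \<Rightarrow> schedule \<Rightarrow> real" where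
  "schedule_length t R S = (if R = {} then 0 else Max (deliver S ` R) - t)"

definition shortest_schedule ::
    "enat \<Rightarrow> real \<Rightarrow> real \<Rightarrow> request set \<Rightarrow> schedule \<Rightarrow> bool" where
  "shortest_schedule c t p R S \<longleftrightarrow>
     feasible_schedule c t p R S \<and>
     (\<forall>S'. feasible_schedule c t p R S' \<longrightarrow> schedule_length t R S \<le> schedule_length t R S')"

text \<open>The infimum is attained for finite \<open>R\<close> and \<open>c \<noteq> 0\<close>; see \<open>L_eq_shortest\<close> and
  \<open>shortest_schedule_exists\<close> below.\<close>

definition L :: "enat \<Rightarrow> real \<Rightarrow> real \<Rightarrow> request set \<Rightarrow> real" where
  "L c t p R = Inf {schedule_length t R S | S. feasible_schedule c t p R S}"

definition Opt :: "enat \<Rightarrow> request set \<Rightarrow> real" where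
  "Opt c \<sigma> = L c 0 0 \<sigma>"


section \<open>Smartstart\<close>

text \<open>
  Shortest schedules are not unique. A tie-breaking rule selects the one that the algorithm
  executes, given its start time, its start position and the set of requests to serve.
\<close>

definition tie_breaking ::
    "enat \<Rightarrow> (real \<Rightarrow> real \<Rightarrow> request set \<Rightarrow> schedule) \<Rightarrow> bool" where
  "tie_breaking c tb \<longleftrightarrow> (\<forall>t p R. finite R \<longrightarrow> shortest_schedule c t p R (tb t p R))"

text \<open>The set \<open>R\<^sub>t\<close>, where \<open>Z\<close> is the set of requests served so far.\<close>

definition pending :: "request set \<Rightarrow> request set \<Rightarrow> real \<Rightarrow> request set" where
  "pending \<sigma> Z t = {q \<in> \<sigma> - Z. rel q \<le> t}"

definition start_time ::
    "enat \<Rightarrow> real \<Rightarrow> request set \<Rightarrow> request set \<Rightarrow> real \<Rightarrow> real \<Rightarrow> real" where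
  "start_time c \<Theta> \<sigma> Z t p =
     (LEAST t'. t \<le> t' \<and> pending \<sigma> Z t' \<noteq> {} \<and> L c t' p (pending \<sigma> Z t') / (\<Theta> - 1) \<le> t')"

text \<open>
  The state \<open>(t, p, Z)\<close> after \<open>j\<close> schedules: the time \<open>t\<close> at which the server becomes idle, its
  position \<open>p\<close> then, and the set \<open>Z\<close> of requests served. States after all of \<open>\<sigma>\<close> has been served
  carry no meaning and are not inspected below.
\<close>

primrec smartstart_state ::
    "(real \<Rightarrow> real \<Rightarrow> request set \<Rightarrow> schedule) \<Rightarrow> enat \<Rightarrow> real \<Rightarrow> request set \<Rightarrow> nat \<Rightarrow>
     real \<times> real \<times> request set" where
  "smartstart_state tb c \<Theta> \<sigma> 0 = (0, 0, {})"
| "smartstart_state tb c \<Theta> \<sigma> (Suc j) =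
     (case smartstart_state tb c \<Theta> \<sigma> j of (t, p, Z) \<Rightarrow>
        let t' = start_time c \<Theta> \<sigma> Z t p;
            R = pending \<sigma> Z t';
            S = tb t' p R;
            e = t' + schedule_length t' R S
        in (e, traj S e, Z \<union> R))"

definition Smartstart ::
    "(real \<Rightarrow> real \<Rightarrow> request set \<Rightarrow> schedule) \<Rightarrow> enat \<Rightarrow> real \<Rightarrow> request set \<Rightarrow> real" where
  "Smartstart tb c \<Theta> \<sigma> =
     fst (smartstart_state tb c \<Theta> \<sigma>
       (LEAST j. snd (snd (smartstart_state tb c \<Theta> \<sigma> j)) = \<sigma>))"


section \<open>The constants\<close>

definition is_Theta_star :: "real \<Rightarrow> bool" where
  "is_Theta_star x \<longleftrightarrow>
     0 < x \<and> x + 1 - (x - 1) / (3 * x + 3) = (2 * x\<^sup>2 + 2 * x) / (x\<^sup>2 + x - 2)"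

definition Theta_star :: real where
  "Theta_star = (THE x. is_Theta_star x)"

definition rho_star :: real where
  "rho_star = (2 * Theta_star\<^sup>2 + 2 * Theta_star) / (Theta_star\<^sup>2 + Theta_star - 2)"

lemma is_Theta_star_iff:
  "is_Theta_star x \<longleftrightarrow> 0 < x \<and> 3 * x^4 + 2 * x^3 - 9 * x\<^sup>2 - 12 * x - 8 = 0"
proof (cases "0 < x")
  case True
  have q: "x\<^sup>2 + x - 2 = (x + 2) * (x - 1)"
    by (simp add: power2_eq_square algebra_simps)
  show ?thesis
  proof (cases "x = 1")
    case True
    then show ?thesis by (simp add: is_Theta_star_def)
  next
    case False
    then have nz: "x\<^sup>2 + x - 2 \<noteq> 0" "3 * x + 3 \<noteq> 0"
      using \<open>0 < x\<close> q by auto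
    have l: "x + 1 - (x - 1) / (3 * x + 3) = (3 * x\<^sup>2 + 5 * x + 4) / (3 * x + 3)"
      using nz by (simp add: field_simps power2_eq_square)
    have "(3 * x\<^sup>2 + 5 * x + 4) * (x\<^sup>2 + x - 2) - (2 * x\<^sup>2 + 2 * x) * (3 * x + 3)
            = 3 * x^4 + 2 * x^3 - 9 * x\<^sup>2 - 12 * x - 8"
      by (simp add: power2_eq_square power3_eq_cube power4_eq_xxxx algebra_simps)
    then show ?thesis
      unfolding is_Theta_star_def l using nz \<open>0 < x\<close> by (auto simp: frac_eq_eq)
  qed
qed (simp add: is_Theta_star_def)

lemma Theta_star_bounds:
  assumes "is_Theta_star x"
  shows "2.052618 < x" "x < 2.052619"
proof -
  have f: "3 * x^4 + 2 * x^3 - 9 * x\<^sup>2 - 12 * x - 8 = 0" and x: "0 < x"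
    using assms by (auto simp: is_Theta_star_iff)
  have f': "x\<^sup>2 * (3 * x\<^sup>2 + 2 * x - 9) = 12 * x + 8"
    using f by (simp add: power2_eq_square power3_eq_cube power4_eq_xxxx algebra_simps)
  have g: "3 * x\<^sup>2 + 2 * x - 9 = 12 / x + 8 / x\<^sup>2"
    using f' x by (simp add: field_simps power2_eq_square)
  show "2.052618 < x"
  proof (rule ccontr)
    assume "\<not> 2.052618 < x"
    then have le: "x \<le> 2.052618" by simp
    have "x\<^sup>2 \<le> 2.052618\<^sup>2" using le x by (intro power_mono) auto
    moreover have "12 / 2.052618 \<le> 12 / x" using le x by (intro divide_left_mono) auto
    moreover have "8 / 2.052618\<^sup>2 \<le> 8 / x\<^sup>2"
      using le x by (intro divide_left_mono power_mono) auto
    ultimately show False using g le by (simp add: power2_eq_square)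
  qed
  show "x < 2.052619"
  proof (rule ccontr)
    assume "\<not> x < 2.052619"
    then have le: "2.052619 \<le> x" by simp
    have "2.052619\<^sup>2 \<le> x\<^sup>2" using le by (intro power_mono) auto
    moreover have "12 / x \<le> 12 / 2.052619" using le x by (intro divide_left_mono) auto
    moreover have "8 / x\<^sup>2 \<le> 8 / 2.052619\<^sup>2"
      using le x by (intro divide_left_mono power_mono) auto
    ultimately show False using g le by (simp add: power2_eq_square)
  qed
qed

lemma ex1_Theta_star: "\<exists>!x. is_Theta_star x"
proof -
  let ?f = "\<lambda>x::real. 3 * x^4 + 2 * x^3 - 9 * x\<^sup>2 - 12 * x - 8"
  have "\<exists>x\<ge>2. x \<le> 3 \<and> ?f x = 0"
    by (rule IVT) (auto intro!: continuous_intros)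
  then obtain x where "2 \<le> x" "?f x = 0" by blast
  then have x: "is_Theta_star x"
    by (simp add: is_Theta_star_iff)
  have less: False if "is_Theta_star a" "is_Theta_star b" "a < b" for a b
  proof -
    have g: "3 * y\<^sup>2 + 2 * y - 9 = 12 / y + 8 / y\<^sup>2" "0 < y" if "is_Theta_star y" for y
    proof -
      have "3 * y^4 + 2 * y^3 - 9 * y\<^sup>2 - 12 * y - 8 = 0" and y: "0 < y"
        using that by (auto simp: is_Theta_star_iff)
      then have "y\<^sup>2 * (3 * y\<^sup>2 + 2 * y - 9) = 12 * y + 8"
        by (simp add: power2_eq_square power3_eq_cube power4_eq_xxxx algebra_simps)
      then show "3 * y\<^sup>2 + 2 * y - 9 = 12 / y + 8 / y\<^sup>2" "0 < y"
        using y by (simp_all add: field_simps power2_eq_square)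
    qed
    have "a\<^sup>2 \<le> b\<^sup>2" using that g(2)[OF that(1)] by (intro power_mono) auto
    moreover have "12 / b \<le> 12 / a"
      using that g(2)[OF that(1)] by (intro divide_left_mono) auto
    moreover have "8 / b\<^sup>2 \<le> 8 / a\<^sup>2"
      using that g(2)[OF that(1)] by (intro divide_left_mono power_mono) auto
    ultimately show False using g(1)[OF that(1)] g(1)[OF that(2)] that(3) by linarith
  qed
  show ?thesis
    using x less by (metis linorder_neqE_linordered_idom)
qed

lemma is_Theta_star_Theta_star: "is_Theta_star Theta_star"
  unfolding Theta_star_def by (rule theI'[OF ex1_Theta_star])

lemma rho_star_approx: "\<bar>rho_star - 2.93768\<bar> < 0.000005"
proof -
  let ?x = Theta_star
  have b: "2.052618 < ?x" "?x < 2.052619"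
    using Theta_star_bounds[OF is_Theta_star_Theta_star] .
  have "rho_star = ?x + 1 - (?x - 1) / (3 * ?x + 3)"
    using is_Theta_star_Theta_star by (simp add: is_Theta_star_def rho_star_def)
  also have "\<dots> = ?x + 2 / 3 + 2 / (3 * (?x + 1))"
    using b by (simp add: field_simps)
  finally have r: "rho_star = ?x + 2 / 3 + 2 / (3 * (?x + 1))" .
  define z where "z = 2 / (3 * (?x + 1))"
  have "z \<le> 0.218393" "0.218391 \<le> z"
    using b by (simp_all add: z_def field_simps)
  with r[folded z_def] b show ?thesis by (simp add: abs_less_iff)
qed


section \<open>Shortest schedules exist\<close>

lemma schedule_length_nonneg:
  assumes "finite R" "feasible_schedule c t p R S"
  shows "0 \<le> schedule_length t R S"
proof (cases "R = {}")
  case False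
  then obtain q where q: "q \<in> R" by auto
  have "t \<le> deliver S q" using assms(2) q by (force simp: feasible_schedule_def)
  also have "\<dots> \<le> Max (deliver S ` R)" using q assms(1) by auto
  finally show ?thesis by (simp add: schedule_length_def)
qed (simp add: schedule_length_def)

lemma L_eq_shortest:
  assumes "shortest_schedule c t p R S"
  shows "L c t p R = schedule_length t R S"
  unfolding L_def
  by (rule cInf_eq_minimum) (use assms in \<open>auto simp: shortest_schedule_def\<close>)

lemma lipschitz_through_points:
  fixes P :: "(real \<times> real) set"
  assumes fin: "finite P" and ne: "P \<noteq> {}"
    and P: "\<And>e v e' v'. (e, v) \<in> P \<Longrightarrow> (e', v') \<in> P \<Longrightarrow> \<bar>v - v'\<bar> \<le> \<bar>e - e'\<bar>"
  shows "\<exists>f. 1-lipschitz_on UNIV f \<and> (\<forall>(e, v)\<in>P. f e = v)"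
proof -
  define f where "f s = Min ((\<lambda>(e, v). v + \<bar>s - e\<bar>) ` P)" for s
  have le: "f s \<le> v + \<bar>s - e\<bar>" if "(e, v) \<in> P" for s e v
    unfolding f_def using that fin by (intro Min_le) force+
  have ge: "\<exists>(e, v)\<in>P. f s = v + \<bar>s - e\<bar>" for s
  proof -
    have "f s \<in> (\<lambda>(e, v). v + \<bar>s - e\<bar>) ` P"
      unfolding f_def using fin ne by (intro Min_in) auto
    then show ?thesis by auto
  qed
  have lip: "f s \<le> f s' + \<bar>s - s'\<bar>" for s s'
  proof -
    obtain e v where ev: "(e, v) \<in> P" "f s' = v + \<bar>s' - e\<bar>" using ge[of s'] by auto
    show ?thesis using le[OF ev(1), of s] ev(2) by linarith
  qed
  have "1-lipschitz_on UNIV f"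
  proof (rule lipschitz_onI)
    fix s s' :: real
    show "dist (f s) (f s') \<le> 1 * dist s s'"
      using lip[of s s'] lip[of s' s] by (simp add: dist_real_def)
  qed simp
  moreover have "f e = v" if ev: "(e, v) \<in> P" for e v
  proof -
    obtain e' v' where ev': "(e', v') \<in> P" "f e = v' + \<bar>e - e'\<bar>" using ge[of e] by auto
    show ?thesis using P[OF ev ev'(1)] ev'(2) le[OF ev, of e] by linarith
  qed
  ultimately show ?thesis by auto
qed

definition events ::
    "real \<Rightarrow> real \<Rightarrow> request set \<Rightarrow> (request \<Rightarrow> real) \<Rightarrow> (request \<Rightarrow> real) \<Rightarrow> (real \<times> real) set" where
  "events t p R u d = insert (t, p) ((\<lambda>q. (u q, src q)) ` R \<union> (\<lambda>q. (d q, dst q)) ` R)"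

lemma feasible_from_times:
  assumes "finite R"
    and "\<And>e v e' v'. (e, v) \<in> events t p R u d \<Longrightarrow> (e', v') \<in> events t p R u d \<Longrightarrow>
           \<bar>v - v'\<bar> \<le> \<bar>e - e'\<bar>"
    and "\<And>q. q \<in> R \<Longrightarrow> t \<le> u q \<and> rel q \<le> u q \<and> u q \<le> d q"
    and "\<And>s. t \<le> s \<Longrightarrow> enat (card {q\<in>R. u q \<le> s \<and> s < d q}) \<le> c"
  shows "\<exists>f. feasible_schedule c t p R \<lparr>traj = f, pickup = u, deliver = d\<rparr>"
proof -
  have "\<exists>f. 1-lipschitz_on UNIV f \<and> (\<forall>(e, v)\<in>events t p R u d. f e = v)"
    using assms(1,2) by (intro lipschitz_through_points) (auto simp: events_def)
  then obtain f where f: "1-lipschitz_on UNIV f" "\<forall>(e, v)\<in>events t p R u d. f e = v"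
    by blast
  have "1-lipschitz_on {t..} f" using f(1) by (rule lipschitz_on_subset) simp
  moreover have "f t = p" "\<And>q. q \<in> R \<Longrightarrow> f (u q) = src q \<and> f (d q) = dst q"
    using f(2) unfolding events_def by (simp, force)
  ultimately show ?thesis
    using assms(3,4) by (intro exI[of _ f]) (auto simp: feasible_schedule_def)
qed

lemma feasible_times:
  assumes "feasible_schedule c t p R S"
    and "(e, v) \<in> events t p R (pickup S) (deliver S)"
    and "(e', v') \<in> events t p R (pickup S) (deliver S)"
  shows "\<bar>v - v'\<bar> \<le> \<bar>e - e'\<bar>"
proof -
  have *: "t \<le> e \<and> traj S e = v" if "(e, v) \<in> events t p R (pickup S) (deliver S)" for e v
    using assms(1) that by (force simp: feasible_schedule_def events_def)
  have "dist (traj S e) (traj S e') \<le> 1 * dist e e'"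
    using assms(1) *[OF assms(2)] *[OF assms(3)]
    by (intro lipschitz_onD[of 1 "{t..}"]) (auto simp: feasible_schedule_def)
  then show ?thesis
    using *[OF assms(2)] *[OF assms(3)] by (simp add: dist_real_def)
qed

lemma feasible_schedule_exists:
  assumes fin: "finite R" and c: "c \<noteq> 0"
  shows "\<exists>S. feasible_schedule c t p R S"
proof -
  define K where "K = 1 + \<bar>p\<bar> + (\<Sum>q\<in>R. \<bar>src q\<bar> + \<bar>dst q\<bar>)"
  define M where "M = \<bar>t\<bar> + (\<Sum>q\<in>R. \<bar>rel q\<bar>)"
  obtain n :: "request \<Rightarrow> nat" where n: "inj_on n R"
    using finite_imp_inj_to_nat_seg[OF fin] by blast
  define u where "u q = M + real (2 * n q + 1) * (2 * K)" for q
  define d where "d q = M + real (2 * n q + 2) * (2 * K)" for q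
  have K1: "1 \<le> K" unfolding K_def by (simp add: sum_nonneg)
  have src_dst: "\<bar>src q\<bar> \<le> K" "\<bar>dst q\<bar> \<le> K" if "q \<in> R" for q
    using member_le_sum[of q R "\<lambda>q. \<bar>src q\<bar> + \<bar>dst q\<bar>"] that fin by (auto simp: K_def)
  have pK: "\<bar>p\<bar> \<le> K" unfolding K_def by (simp add: sum_nonneg)
  have "0 \<le> (\<Sum>q\<in>R. \<bar>rel q\<bar>)" by (simp add: sum_nonneg)
  then have tM: "t \<le> M" unfolding M_def by linarith
  have relM: "rel q \<le> M" if "q \<in> R" for q
    using member_le_sum[of q R "\<lambda>q. \<bar>rel q\<bar>"] that fin by (auto simp: M_def)
  have gap: "2 * K \<le> \<bar>real i * (2 * K) - real j * (2 * K)\<bar>" if "i \<noteq> j" for i j :: nat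
  proof -
    have "1 \<le> \<bar>real i - real j\<bar>" using that by linarith
    then have "1 * (2 * K) \<le> \<bar>real i - real j\<bar> * (2 * K)"
      using K1 by (intro mult_right_mono) auto
    also have "\<dots> = \<bar>real i * (2 * K) - real j * (2 * K)\<bar>"
      using K1 by (simp add: abs_mult left_diff_distrib[symmetric])
    finally show ?thesis by simp
  qed
  have late: "M + 2 * K \<le> M + real (Suc i) * (2 * K)" for i
    using K1 by (simp add: algebra_simps)
  have ev: "(e = t \<and> v = p) \<or>
      (\<exists>q\<in>R. (e = M + real (Suc (2 * n q)) * (2 * K) \<and> v = src q) \<or>
             (e = M + real (Suc (2 * n q + 1)) * (2 * K) \<and> v = dst q))"
    if "(e, v) \<in> events t p R u d" for e v
    using that by (auto simp: events_def u_def d_def)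
  have pts: "\<bar>v\<bar> \<le> K" if "(e, v) \<in> events t p R u d" for e v
    using that pK src_dst by (auto simp: events_def)
  have "\<exists>f. feasible_schedule c t p R \<lparr>traj = f, pickup = u, deliver = d\<rparr>"
  proof (rule feasible_from_times[OF fin])
    fix e v e' v'
    assume 1: "(e, v) \<in> events t p R u d" and 2: "(e', v') \<in> events t p R u d"
    have far: "\<bar>v - v'\<bar> \<le> \<bar>e - e'\<bar>" if "2 * K \<le> \<bar>e - e'\<bar>"
      using pts[OF 1] pts[OF 2] that by linarith
    have idx: "(e = t \<and> v = p) \<or> (\<exists>i. e = M + real (Suc i) * (2 * K))"
      if "(e, v) \<in> events t p R u d" for e v
      using ev[OF that] by blast
    show "\<bar>v - v'\<bar> \<le> \<bar>e - e'\<bar>"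
    proof (cases "e = e'")
      case False
      have "2 * K \<le> \<bar>e - e'\<bar>"
        using idx[OF 1]
      proof (elim disjE exE conjE)
        fix i assume e: "e = M + real (Suc i) * (2 * K)"
        show ?thesis
          using idx[OF 2]
        proof (elim disjE exE conjE)
          fix j assume e': "e' = M + real (Suc j) * (2 * K)"
          have "Suc i \<noteq> Suc j" using e e' False by auto
          from gap[OF this] show ?thesis by (simp add: e e')
        qed (use late[of i] tM e in linarith)
      next
        assume e: "e = t"
        show ?thesis
          using idx[OF 2]
        proof (elim disjE exE conjE)
          fix j assume e': "e' = M + real (Suc j) * (2 * K)"
          show ?thesis using late[of j] tM e e' by linarith
        qed (use False e in auto)
      qed
      then show ?thesis by (rule far)
    next
      case True
      have inj: "i = j" if "M + real i * (2 * K) = M + real j * (2 * K)" for i j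
        using that gap[of i j] K1 by force
      have "e = t \<Longrightarrow> e \<noteq> M + real (Suc i) * (2 * K)" for i
        using late[of i] tM K1 by linarith
      then have "v = v'"
        using ev[OF 1] ev[OF 2] True
      proof (elim disjE bexE conjE)
        fix q q' assume q: "q \<in> R" "q' \<in> R"
        { assume "e = M + real (Suc (2 * n q)) * (2 * K)" "v = src q"
            "e' = M + real (Suc (2 * n q')) * (2 * K)" "v' = src q'"
          then have "Suc (2 * n q) = Suc (2 * n q')" using True by (intro inj) metis
          then have "q = q'" using n q by (auto dest: inj_onD)
          then show "v = v'" using \<open>v = src q\<close> \<open>v' = src q'\<close> by simp }
        { assume "e = M + real (Suc (2 * n q + 1)) * (2 * K)" "v = dst q"
            "e' = M + real (Suc (2 * n q' + 1)) * (2 * K)" "v' = dst q'"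
          then have "Suc (2 * n q + 1) = Suc (2 * n q' + 1)" using True by (intro inj) metis
          then have "q = q'" using n q by (auto dest: inj_onD)
          then show "v = v'" using \<open>v = dst q\<close> \<open>v' = dst q'\<close> by simp }
        { assume "e = M + real (Suc (2 * n q)) * (2 * K)"
            "e' = M + real (Suc (2 * n q' + 1)) * (2 * K)"
          then have "Suc (2 * n q) = Suc (2 * n q' + 1)" using True by (intro inj) metis
          then have False by presburger
          then show "v = v'" .. }
        { assume "e = M + real (Suc (2 * n q + 1)) * (2 * K)"
            "e' = M + real (Suc (2 * n q')) * (2 * K)"
          then have "Suc (2 * n q + 1) = Suc (2 * n q')" using True by (intro inj) metis
          then have False by presburger
          then show "v = v'" .. }
      qed metis+
      then show ?thesis by simp
    qed
  next
    fix q assume "q \<in> R"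
    show "t \<le> u q \<and> rel q \<le> u q \<and> u q \<le> d q"
    proof -
      have "M \<le> u q" using late[of "2 * n q"] K1 by (simp add: u_def)
      moreover have "u q \<le> d q" using K1 by (auto simp: u_def d_def intro!: mult_right_mono)
      ultimately show ?thesis using tM relM[OF \<open>q \<in> R\<close>] by linarith
    qed
  next
    fix s
    have "q = q'" if "q \<in> R" "q' \<in> R" "u q \<le> s" "s < d q" "u q' \<le> s" "s < d q'" for q q'
    proof -
      have *: "n a \<le> n b" if "u a \<le> s" "s < d b" for a b
      proof -
        have "real (2 * n a + 1) * (2 * K) < real (2 * n b + 2) * (2 * K)"
          using that by (simp add: u_def d_def)
        then have "2 * n a + 1 < 2 * n b + 2"
          using K1 by (simp only: mult_less_cancel_right of_nat_less_iff)
        then show ?thesis by simp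
      qed
      show ?thesis using *[of q q'] *[of q' q] that n by (auto dest: inj_onD)
    qed
    then have "card {q\<in>R. u q \<le> s \<and> s < d q} \<le> 1"
      using fin by (intro card_le_Suc0_iff_eq[THEN iffD2, simplified One_nat_def[symmetric]]) auto
    also have "enat 1 \<le> c" using c by (cases c) (auto simp: zero_enat_def)
    finally show "enat (card {q\<in>R. u q \<le> s \<and> s < d q}) \<le> c" by simp
  qed
  then show ?thesis by blast
qed

lemma common_convergent_subseq:
  fixes F :: "nat \<Rightarrow> 'a \<Rightarrow> real"
  assumes "finite A" and "\<And>a. a \<in> A \<Longrightarrow> bounded (range (\<lambda>k. F k a))"
  shows "\<exists>r. strict_mono (r :: nat \<Rightarrow> nat) \<and> (\<forall>a\<in>A. convergent (\<lambda>k. F (r k) a))"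
  using assms
proof (induction A)
  case empty
  show ?case by (intro exI[of _ id]) (auto simp: strict_mono_def)
next
  case (insert a A)
  then obtain r :: "nat \<Rightarrow> nat"
    where r: "strict_mono r" "\<forall>a\<in>A. convergent (\<lambda>k. F (r k) a)" by auto
  have "bounded (range (\<lambda>k. F (r k) a))"
    by (rule bounded_subset[of "range (\<lambda>k. F k a)"]) (use insert.prems in auto)
  then obtain l r' where r': "strict_mono r'" "((\<lambda>k. F (r k) a) \<circ> r') \<longlonglongrightarrow> l"
    using bounded_imp_convergent_subsequence by blast
  have "convergent (\<lambda>k. F (r (r' k)) b)" if "b \<in> insert a A" for b
  proof (cases "b = a")
    case True
    then show ?thesis using r'(2) by (auto simp: convergent_def o_def)
  next
    case False
    then have "convergent (\<lambda>k. F (r k) b)" using r(2) that by auto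
    from convergent_subseq_convergent[OF this r'(1)] show ?thesis by (simp add: o_def)
  qed
  then show ?case
    using r(1) r'(1) by (intro exI[of _ "r \<circ> r'"]) (auto simp: strict_mono_def)
qed

theorem shortest_schedule_exists:
  assumes fin: "finite R" and c: "c \<noteq> 0"
  shows "\<exists>S. shortest_schedule c t p R S"
proof (cases "R = {}")
  case True
  obtain S where "feasible_schedule c t p R S"
    using feasible_schedule_exists[OF assms] by blast
  then show ?thesis using True by (auto simp: shortest_schedule_def schedule_length_def)
next
  case False
  define X where "X = {schedule_length t R S | S. feasible_schedule c t p R S}"
  have X: "X \<noteq> {}" "bdd_below X"
    using feasible_schedule_exists[OF assms, of t p] schedule_length_nonneg[OF fin]
    by (auto simp: X_def intro!: bdd_belowI[of _ 0])
  have "\<exists>S. feasible_schedule c t p R S \<and> schedule_length t R S < Inf X + inverse (real (Suc k))"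
    for k
  proof -
    have "\<exists>x\<in>X. x < Inf X + inverse (real (Suc k))"
      using X by (subst cInf_less_iff[symmetric]) auto
    then show ?thesis by (auto simp: X_def)
  qed
  then obtain Sq where Sq: "\<And>k. feasible_schedule c t p R (Sq k)"
    "\<And>k. schedule_length t R (Sq k) < Inf X + inverse (real (Suc k))"
    by metis
  define B where "B = t + Inf X + 1"
  have del: "deliver (Sq k) q \<le> t + schedule_length t R (Sq k)" if "q \<in> R" for k q
    using that fin by (auto simp: schedule_length_def)
  have inv1: "inverse (real (Suc k)) \<le> 1" for k by (simp add: field_simps)
  have rng: "t \<le> pickup (Sq k) q" "rel q \<le> pickup (Sq k) q" "pickup (Sq k) q \<le> deliver (Sq k) q"
    "deliver (Sq k) q \<le> B" if "q \<in> R" for k q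
  proof -
    show "t \<le> pickup (Sq k) q" "rel q \<le> pickup (Sq k) q" "pickup (Sq k) q \<le> deliver (Sq k) q"
      using Sq(1)[of k] that by (auto simp: feasible_schedule_def)
    show "deliver (Sq k) q \<le> B"
      using Sq(2)[of k] del[OF that, of k] inv1[of k] unfolding B_def by linarith
  qed
  have bu: "bounded (range (\<lambda>k. pickup (Sq k) q))" and bd: "bounded (range (\<lambda>k. deliver (Sq k) q))"
    if "q \<in> R" for q
  proof -
    have "range (\<lambda>k. pickup (Sq k) q) \<subseteq> {t..B}" "range (\<lambda>k. deliver (Sq k) q) \<subseteq> {t..B}"
      using order_trans[OF rng(3)[OF that] rng(4)[OF that]]
        order_trans[OF rng(1)[OF that] rng(3)[OF that]] rng[OF that] by auto
    then show "bounded (range (\<lambda>k. pickup (Sq k) q))" "bounded (range (\<lambda>k. deliver (Sq k) q))"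
      using bounded_subset[OF bounded_closed_interval] by blast+
  qed
  obtain r1 :: "nat \<Rightarrow> nat" where r1: "strict_mono r1"
    "\<forall>q\<in>R. convergent (\<lambda>k. pickup (Sq (r1 k)) q)"
    using common_convergent_subseq[OF fin, of "\<lambda>k. pickup (Sq k)"] bu by blast
  have "bounded (range (\<lambda>k. deliver (Sq (r1 k)) q))" if "q \<in> R" for q
    by (rule bounded_subset[OF bd[OF that]]) auto
  then obtain r2 :: "nat \<Rightarrow> nat" where r2: "strict_mono r2"
    "\<forall>q\<in>R. convergent (\<lambda>k. deliver (Sq (r1 (r2 k))) q)"
    using common_convergent_subseq[OF fin, of "\<lambda>k. deliver (Sq (r1 k))"] by blast
  define T where "T k = Sq (r1 (r2 k))" for k
  have "convergent (\<lambda>k. pickup (T k) q)" if "q \<in> R" for q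
    using convergent_subseq_convergent[OF _ r2(1), of "\<lambda>k. pickup (Sq (r1 k)) q"] r1(2) that
    by (auto simp: T_def o_def)
  then have "\<forall>q\<in>R. \<exists>l. (\<lambda>k. pickup (T k) q) \<longlonglongrightarrow> l" by (simp add: convergent_def)
  then obtain u where u: "\<And>q. q \<in> R \<Longrightarrow> (\<lambda>k. pickup (T k) q) \<longlonglongrightarrow> u q" by metis
  have "\<forall>q\<in>R. \<exists>l. (\<lambda>k. deliver (T k) q) \<longlonglongrightarrow> l"
    using r2(2) by (simp add: convergent_def T_def)
  then obtain d where d: "\<And>q. q \<in> R \<Longrightarrow> (\<lambda>k. deliver (T k) q) \<longlonglongrightarrow> d q" by metis
  have feas: "feasible_schedule c t p R (T k)" for k using Sq(1) by (simp add: T_def)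
  have "\<exists>f. feasible_schedule c t p R \<lparr>traj = f, pickup = u, deliver = d\<rparr>"
  proof (rule feasible_from_times[OF fin])
    fix e v e' v'
    assume 1: "(e, v) \<in> events t p R u d" and 2: "(e', v') \<in> events t p R u d"
    have approx: "\<exists>g. g \<longlonglongrightarrow> e \<and> (\<forall>k. (g k, v) \<in> events t p R (pickup (T k)) (deliver (T k)))"
      if "(e, v) \<in> events t p R u d" for e v
      using that unfolding events_def
    proof (elim insertE UnE imageE)
      assume "(e, v) = (t, p)"
      then show "\<exists>g. g \<longlonglongrightarrow> e \<and> (\<forall>k. (g k, v) \<in> insert (t, p) ((\<lambda>q. (pickup (T k) q, src q)) ` R \<union> (\<lambda>q. (deliver (T k) q, dst q)) ` R))"
        by (intro exI[of _ "\<lambda>_. t"]) auto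
    next
      fix q assume "(e, v) = (u q, src q)" "q \<in> R"
      then show "\<exists>g. g \<longlonglongrightarrow> e \<and> (\<forall>k. (g k, v) \<in> insert (t, p) ((\<lambda>q. (pickup (T k) q, src q)) ` R \<union> (\<lambda>q. (deliver (T k) q, dst q)) ` R))"
        using u by (intro exI[of _ "\<lambda>k. pickup (T k) q"]) auto
    next
      fix q assume "(e, v) = (d q, dst q)" "q \<in> R"
      then show "\<exists>g. g \<longlonglongrightarrow> e \<and> (\<forall>k. (g k, v) \<in> insert (t, p) ((\<lambda>q. (pickup (T k) q, src q)) ` R \<union> (\<lambda>q. (deliver (T k) q, dst q)) ` R))"
        using d by (intro exI[of _ "\<lambda>k. deliver (T k) q"]) auto
    qed
    obtain g where g: "g \<longlonglongrightarrow> e" "\<And>k. (g k, v) \<in> events t p R (pickup (T k)) (deliver (T k))"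
      using approx[OF 1] by blast
    obtain g' where g': "g' \<longlonglongrightarrow> e'" "\<And>k. (g' k, v') \<in> events t p R (pickup (T k)) (deliver (T k))"
      using approx[OF 2] by blast
    have "(\<lambda>k. \<bar>g k - g' k\<bar>) \<longlonglongrightarrow> \<bar>e - e'\<bar>" using g(1) g'(1) by (intro tendsto_intros)
    then show "\<bar>v - v'\<bar> \<le> \<bar>e - e'\<bar>"
      using feasible_times[OF feas g(2) g'(2)] by (intro LIMSEQ_le_const) auto
  next
    fix q assume q: "q \<in> R"
    have "t \<le> u q" "rel q \<le> u q"
      using LIMSEQ_le_const[OF u[OF q]] rng(1,2)[OF q] by (auto simp: T_def)
    moreover have "u q \<le> d q"
      using LIMSEQ_le[OF u[OF q] d[OF q]] rng(3)[OF q] by (auto simp: T_def)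
    ultimately show "t \<le> u q \<and> rel q \<le> u q \<and> u q \<le> d q" by blast
  next
    fix s assume s: "t \<le> s"
    define Q where "Q = {q\<in>R. u q \<le> s \<and> s < d q}"
    have finQ: "finite Q" using fin by (simp add: Q_def)
    define m where "m = Min (insert (s + 1) (d ` Q))"
    have m: "s < m" "\<And>q. q \<in> Q \<Longrightarrow> m \<le> d q"
      using finQ by (auto simp: m_def Q_def)
    define s' where "s' = (s + m) / 2"
    have s': "s < s'" "s' < m" using m(1) by (auto simp: s'_def)
    have "eventually (\<lambda>k. pickup (T k) q < s' \<and> s' < deliver (T k) q) sequentially" if "q \<in> Q" for q
    proof -
      have "u q < s'" "s' < d q" "q \<in> R" using that s' m(2)[OF that] by (auto simp: Q_def)
      then show ?thesis
        using order_tendstoD(2)[OF u] order_tendstoD(1)[OF d] by (intro eventually_conj) auto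
    qed
    then have "eventually (\<lambda>k. \<forall>q\<in>Q. pickup (T k) q < s' \<and> s' < deliver (T k) q) sequentially"
      using finQ by (simp add: eventually_ball_finite_distrib)
    then obtain k where k: "\<And>q. q \<in> Q \<Longrightarrow> pickup (T k) q < s' \<and> s' < deliver (T k) q"
      by (auto simp: eventually_sequentially)
    have "card Q \<le> card {q\<in>R. pickup (T k) q \<le> s' \<and> s' < deliver (T k) q}"
      using k fin by (intro card_mono) (auto simp: Q_def less_imp_le)
    moreover have "enat (card {q\<in>R. pickup (T k) q \<le> s' \<and> s' < deliver (T k) q}) \<le> c"
      using feas[of k] s s' by (auto simp: feasible_schedule_def)
    ultimately have "enat (card Q) \<le> c" by (meson enat_ord_simps(1) order_trans)
    then show "enat (card {q\<in>R. u q \<le> s \<and> s < d q}) \<le> c" by (simp add: Q_def)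
  qed
  then obtain f where f: "feasible_schedule c t p R \<lparr>traj = f, pickup = u, deliver = d\<rparr>" ..
  have sub: "strict_mono (\<lambda>k. r1 (r2 k))"
    using r1(1) r2(1) by (simp add: strict_mono_def)
  have "(\<lambda>k. t + (Inf X + inverse (real (Suc k)))) \<longlonglongrightarrow> t + (Inf X + 0)"
    by (intro tendsto_intros LIMSEQ_inverse_real_of_nat)
  then have lim: "(\<lambda>k. t + (Inf X + inverse (real (Suc (r1 (r2 k)))))) \<longlonglongrightarrow> t + Inf X"
    using LIMSEQ_subseq_LIMSEQ[OF _ sub] by (fastforce simp: o_def)
  have "d q \<le> t + Inf X" if "q \<in> R" for q
  proof (rule LIMSEQ_le[OF d[OF that] lim], intro exI allI impI)
    fix k
    show "deliver (T k) q \<le> t + (Inf X + inverse (real (Suc (r1 (r2 k)))))"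
      using del[OF that, of "r1 (r2 k)"] Sq(2)[of "r1 (r2 k)"] unfolding T_def by linarith
  qed
  then have "schedule_length t R \<lparr>traj = f, pickup = u, deliver = d\<rparr> \<le> Inf X"
    using False fin by (simp add: schedule_length_def algebra_simps)
  moreover have "Inf X \<le> schedule_length t R S'" if "feasible_schedule c t p R S'" for S'
    using X(2) that by (intro cInf_lower) (auto simp: X_def)
  ultimately show ?thesis using f unfolding shortest_schedule_def by (meson order_trans)
qed

corollary tie_breaking_exists:
  assumes "c \<noteq> 0"
  shows "\<exists>tb. tie_breaking c tb"
proof -
  have "tie_breaking c (\<lambda>t p R. SOME S. shortest_schedule c t p R S)"
    using shortest_schedule_exists[OF _ assms] by (auto simp: tie_breaking_def intro: someI_ex)
  then show ?thesis by blast
qed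

end

theory Submission
  imports Defs
begin

text \<open>
  Put \<open>w = 1 / (\<Theta> - 1)\<close>. A schedule of length \<open>l\<close> is not started before time \<open>l * w\<close> and hence
  not completed before \<open>(1 + w) * l\<close>. In each instance the server is lured to the right while the
  offline optimum walks to the leftmost point \<open>-a\<close>, where a request appears as soon as the server
  can no longer react; from there the optimum sweeps to the rightmost point \<open>hi\<close> once and is done at
  time \<open>2 * a + hi\<close>. For \<open>\<Theta> \<le> 2\<close> the request at \<open>-a\<close> is a transport to \<open>hi\<close>, so the server has to
  go all the way back and forth after a long wait. For larger \<open>\<Theta>\<close> its last but one schedule ends at
  \<open>-a\<close>, and a request released at \<open>hi\<close> in the meantime makes it cross the line once more. The
  release times are separated from all start times that occur for the parameters of the interval,
  so one instance serves all of them.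
\<close>


section \<open>Routes\<close>

lemma feasible_dist:
  assumes "feasible_schedule c t p R S" "t \<le> a" "t \<le> b"
  shows "\<bar>traj S a - traj S b\<bar> \<le> \<bar>a - b\<bar>"
  using assms lipschitz_onD[of 1 "{t..}" "traj S" a b]
  by (auto simp: feasible_schedule_def dist_real_def)

lemma feasible_request:
  assumes "feasible_schedule c t p R S" "q \<in> R"
  shows "t \<le> pickup S q" "rel q \<le> pickup S q" "pickup S q \<le> deliver S q"
    "traj S (pickup S q) = src q" "traj S (deliver S q) = dst q"
  using assms by (auto simp: feasible_schedule_def)

lemma feasible_start: "feasible_schedule c t p R S \<Longrightarrow> traj S t = p"
  by (simp add: feasible_schedule_def)

text \<open>Length and end position are demanded of every shortest schedule, so a run composed of
  tours is the same for every tie-breaking rule. Once all requests are released, neither depends on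
  the start time.\<close>

definition tour :: "enat \<Rightarrow> real \<Rightarrow> request set \<Rightarrow> real \<Rightarrow> real \<Rightarrow> bool" where
  "tour c p R l x \<longleftrightarrow> (\<forall>t. (\<forall>q\<in>R. rel q \<le> t) \<longrightarrow>
     L c t p R = l \<and> (\<forall>S. shortest_schedule c t p R S \<longrightarrow> traj S (t + l) = x))"

lemma tourD:
  assumes "tour c p R l x" "\<And>q. q \<in> R \<Longrightarrow> rel q \<le> t"
  shows "L c t p R = l" "shortest_schedule c t p R S \<Longrightarrow> traj S (t + l) = x"
  using assms by (auto simp: tour_def)

lemma last_delivery:
  assumes "finite R" "R \<noteq> {}"
  obtains q where "q \<in> R" "\<And>q'. q' \<in> R \<Longrightarrow> deliver S q' \<le> deliver S q"
    "t + schedule_length t R S = deliver S q"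
proof -
  have "Max (deliver S ` R) \<in> deliver S ` R" using assms by (intro Max_in) auto
  then obtain q where q: "q \<in> R" "Max (deliver S ` R) = deliver S q" by auto
  moreover have "deliver S q' \<le> deliver S q" if "q' \<in> R" for q'
    using that assms by (simp flip: q(2))
  ultimately show thesis using assms by (intro that) (auto simp: schedule_length_def)
qed

text \<open>One schedule finishing by \<open>t + l\<close> caps the shortest length, and the bound
  on the last delivery makes \<open>l\<close> exact. The server ends at the destination of the last
  request, which equality forces to be \<open>x\<close>.\<close>

lemma tourI:
  assumes fin: "finite R" and ne: "R \<noteq> {}" and c: "c \<noteq> 0"
    and upper: "\<And>t. (\<forall>q\<in>R. rel q \<le> t) \<Longrightarrow>
      \<exists>S. feasible_schedule c t p R S \<and> (\<forall>q\<in>R. deliver S q \<le> t + l)"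
    and lower: "\<And>t S q. feasible_schedule c t p R S \<Longrightarrow> q \<in> R \<Longrightarrow>
      (\<And>q'. q' \<in> R \<Longrightarrow> deliver S q' \<le> deliver S q) \<Longrightarrow>
      t + l \<le> deliver S q \<and> (deliver S q = t + l \<longrightarrow> dst q = x)"
  shows "tour c p R l x"
  unfolding tour_def
proof (intro allI impI)
  fix t assume t: "\<forall>q\<in>R. rel q \<le> t"
  have *: "L c t p R = l \<and> traj S (t + l) = x" if S: "shortest_schedule c t p R S" for S
  proof -
    have f: "feasible_schedule c t p R S" using S by (simp add: shortest_schedule_def)
    obtain S0 where S0: "feasible_schedule c t p R S0" "\<forall>q\<in>R. deliver S0 q \<le> t + l"
      using upper[OF t] by blast
    obtain q0 where "q0 \<in> R" "t + schedule_length t R S0 = deliver S0 q0"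
      using last_delivery[OF fin ne, where S = S0 and t = t] by metis
    then have "schedule_length t R S0 \<le> l" using S0(2) by force
    moreover have "schedule_length t R S \<le> schedule_length t R S0"
      using S S0(1) by (simp add: shortest_schedule_def)
    ultimately have le: "schedule_length t R S \<le> l" by linarith
    obtain q where q: "q \<in> R" "\<And>q'. q' \<in> R \<Longrightarrow> deliver S q' \<le> deliver S q"
      "t + schedule_length t R S = deliver S q"
      using last_delivery[OF fin ne, where S = S and t = t] by metis
    have ge: "t + l \<le> deliver S q" "deliver S q = t + l \<longrightarrow> dst q = x"
      using lower[OF f q(1,2)] by auto
    have len: "schedule_length t R S = l" using ge(1) le q(3) by linarith
    then have "traj S (t + l) = x"
      using feasible_request(5)[OF f q(1)] q(3) ge(2) by simp
    then show ?thesis using len L_eq_shortest[OF S] by simp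
  qed
  then show "L c t p R = l \<and> (\<forall>S. shortest_schedule c t p R S \<longrightarrow> traj S (t + l) = x)"
    using shortest_schedule_exists[OF fin c] by blast
qed

lemma enat_card_le:
  assumes "c \<noteq> 0" "finite A" "\<And>a b. a \<in> A \<Longrightarrow> b \<in> A \<Longrightarrow> a = b"
  shows "enat (card A) \<le> c"
proof -
  have "card A \<le> 1" using assms(2,3) by (simp add: card_le_Suc0_iff_eq)
  also have "enat 1 \<le> c" using assms(1) by (cases c) (auto simp: zero_enat_def)
  finally show ?thesis by simp
qed

section \<open>Sweeps to the right\<close>

text \<open>In a sweep to the right this keeps the load at one or less, which fits every
  \<open>c \<noteq> 0\<close>. A request with \<open>dst q = src q\<close> is delivered at the
  instant of its pickup and never adds to the load.\<close>

definition non_overlapping :: "request set \<Rightarrow> bool" where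
  "non_overlapping R \<longleftrightarrow> (\<forall>q\<in>R. \<forall>q'\<in>R. q \<noteq> q' \<longrightarrow>
     dst q \<le> src q \<or> dst q' \<le> src q' \<or> dst q \<le> src q' \<or> dst q' \<le> src q)"

lemma non_overlapping_points: "(\<And>q. q \<in> R \<Longrightarrow> dst q = src q) \<Longrightarrow> non_overlapping R"
  by (simp add: non_overlapping_def)

text \<open>The server first goes left to \<open>lo\<close> and then right for ever, serving each request when it
  passes it.\<close>

lemma feasible_dip_sweep:
  assumes fin: "finite R" and c: "c \<noteq> 0" and lo: "lo \<le> p"
    and q: "\<And>q. q \<in> R \<Longrightarrow> lo \<le> src q \<and> src q \<le> dst q \<and> rel q \<le> t + (p - lo) + (src q - lo)"
    and no: "non_overlapping R"
  shows "\<exists>S. feasible_schedule c t p R S \<and> (\<forall>q\<in>R. deliver S q = t + (p - lo) + (dst q - lo))"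
proof -
  define u where "u q = t + (p - lo) + (src q - lo)" for q
  define d where "d q = t + (p - lo) + (dst q - lo)" for q
  have "\<exists>f. feasible_schedule c t p R \<lparr>traj = f, pickup = u, deliver = d\<rparr>"
  proof (rule feasible_from_times[OF fin])
    \<comment> \<open>After the dip all events lie on one line of slope one, so only pairs with the
      starting point \<open>(t, p)\<close> involve the detour.\<close>
    have ev: "(e, v) = (t, p) \<or> (lo \<le> v \<and> e = t + (p - lo) + (v - lo))"
      if "(e, v) \<in> events t p R u d" for e v
      using that q by (force simp: events_def u_def d_def)
    fix e v e' v'
    assume "(e, v) \<in> events t p R u d" "(e', v') \<in> events t p R u d"
    from ev[OF this(1)] ev[OF this(2)] show "\<bar>v - v'\<bar> \<le> \<bar>e - e'\<bar>"
      using lo by auto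
  next
    fix s
    show "enat (card {q \<in> R. u q \<le> s \<and> s < d q}) \<le> c"
    proof (rule enat_card_le[OF c])
      fix a b
      assume "a \<in> {q \<in> R. u q \<le> s \<and> s < d q}" "b \<in> {q \<in> R. u q \<le> s \<and> s < d q}"
      then show "a = b"
        using no by (force simp: non_overlapping_def u_def d_def)
    qed (use fin in simp)
  qed (use q lo in \<open>force simp: u_def d_def\<close>)
  then show ?thesis by (force simp: d_def)
qed

text \<open>The lower bound comes from \<open>q0\<close> alone: it ends at \<open>hi\<close>, and
  either its pickup is at \<open>lo\<close> or the server starts there. All other requests are
  served on the way.\<close>

lemma tour_dip_sweep:
  assumes fin: "finite R" and c: "c \<noteq> 0" and lo: "lo \<le> p"
    and q: "\<And>q. q \<in> R \<Longrightarrow> lo \<le> src q \<and> src q \<le> dst q \<and> dst q \<le> hi"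
    and no: "non_overlapping R"
    and far: "q0 \<in> R" "dst q0 = hi" "src q0 = lo \<or> p = lo"
  shows "tour c p R (p - lo + (hi - lo)) hi"
proof (rule tourI[OF fin _ c])
  show "R \<noteq> {}" using far(1) by auto
next
  fix t assume "\<forall>q\<in>R. rel q \<le> t"
  then obtain S where S: "feasible_schedule c t p R S"
    "\<forall>q\<in>R. deliver S q = t + (p - lo) + (dst q - lo)"
    using feasible_dip_sweep[OF fin c lo _ no, of t] q lo by force
  then show "\<exists>S. feasible_schedule c t p R S \<and> (\<forall>q\<in>R. deliver S q \<le> t + (p - lo + (hi - lo)))"
    using q by force
next
  fix t S q'
  assume S: "feasible_schedule c t p R S" and q': "q' \<in> R"
    and last: "\<And>q''. q'' \<in> R \<Longrightarrow> deliver S q'' \<le> deliver S q'"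
  note q0 = feasible_request[OF S far(1)]
  have "\<bar>p - src q0\<bar> \<le> \<bar>t - pickup S q0\<bar>" "\<bar>src q0 - hi\<bar> \<le> \<bar>pickup S q0 - deliver S q0\<bar>"
    "\<bar>p - hi\<bar> \<le> \<bar>t - deliver S q0\<bar>"
    using feasible_dist[OF S, of t "pickup S q0"] feasible_dist[OF S, of t "deliver S q0"]
      feasible_dist[OF S, of "pickup S q0" "deliver S q0"] q0 far(2) feasible_start[OF S] by auto
  then have ge: "t + (p - lo + (hi - lo)) \<le> deliver S q0"
    using far(3) q0(1,3) lo q[OF far(1)] by linarith
  moreover have "dst q' = hi" if "deliver S q' = deliver S q0"
    using that feasible_request(5)[OF S q'] q0(5) far(2) by simp
  ultimately show "t + (p - lo + (hi - lo)) \<le> deliver S q' \<and>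
      (deliver S q' = t + (p - lo + (hi - lo)) \<longrightarrow> dst q' = hi)"
    using last[OF far(1)] by force
qed

corollary tour_sweep:
  assumes "finite R" "c \<noteq> 0" "\<And>q. q \<in> R \<Longrightarrow> p \<le> src q \<and> src q \<le> dst q \<and> dst q \<le> hi"
    and "non_overlapping R" "q0 \<in> R" "dst q0 = hi"
  shows "tour c p R (hi - p) hi"
  using tour_dip_sweep[where lo = p] assms by fastforce

section \<open>Trips that end on the left\<close>

text \<open>\<open>less\<close> says that doing the transport first is shorter than visiting
  \<open>lo\<close> first. It also implies \<open>h + lo < 2 * m\<close>, which makes a detour to
  \<open>lo\<close> with the transport on board too long. So every shortest schedule ends at
  \<open>lo\<close>.\<close>

lemma tour_transport_then_point:
  assumes c: "c \<noteq> 0" and A: "m \<le> h" and C: "lo < m" "lo < p"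
    and less: "\<bar>p - m\<bar> + h < p + m - lo"
  shows "tour c p {Request m h r, Request lo lo r'} (\<bar>p - m\<bar> + (h - m) + (h - lo)) lo"
    (is "tour c p {?A, ?C} ?l lo")
proof (rule tourI[OF _ _ c])
  fix t assume rel: "\<forall>q\<in>{?A, ?C}. rel q \<le> t"
  have ne: "?A \<noteq> ?C" using C by auto
  define u where "u q = (if q = ?A then t + \<bar>p - m\<bar> else t + ?l)" for q
  define d where "d q = (if q = ?A then t + \<bar>p - m\<bar> + (h - m) else t + ?l)" for q
  have "\<exists>f. feasible_schedule c t p {?A, ?C} \<lparr>traj = f, pickup = u, deliver = d\<rparr>"
  proof (rule feasible_from_times)
    fix s
    show "enat (card {q \<in> {?A, ?C}. u q \<le> s \<and> s < d q}) \<le> c"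
      by (rule enat_card_le[OF c]) (use C in \<open>auto simp: u_def d_def\<close>)
  qed (use rel ne A C in \<open>auto simp: events_def u_def d_def\<close>)
  then obtain f where "feasible_schedule c t p {?A, ?C} \<lparr>traj = f, pickup = u, deliver = d\<rparr>" ..
  moreover have "\<forall>q\<in>{?A, ?C}. d q \<le> t + ?l" using A C by (auto simp: d_def)
  ultimately show "\<exists>S. feasible_schedule c t p {?A, ?C} S \<and> (\<forall>q\<in>{?A, ?C}. deliver S q \<le> t + ?l)"
    by (intro exI[of _ "\<lparr>traj = f, pickup = u, deliver = d\<rparr>"]) simp
next
  fix t S q
  assume S: "feasible_schedule c t p {?A, ?C} S" and q: "q \<in> {?A, ?C}"
    and last: "\<And>q'. q' \<in> {?A, ?C} \<Longrightarrow> deliver S q' \<le> deliver S q"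
  define a a' g where abg: "a = pickup S ?A" "a' = deliver S ?A" "g = deliver S ?C"
  have Q: "t \<le> a" "a \<le> a'" "traj S a = m" "traj S a' = h" "t \<le> g" "traj S g = lo"
    using feasible_request[OF S, of ?A] feasible_request[OF S, of ?C] by (auto simp: abg)
  have gap: "\<bar>traj S x - traj S y\<bar> \<le> y - x" if "t \<le> x" "x \<le> y" for x y
    using feasible_dist[OF S, of x y] that by simp
  have ta: "\<bar>p - m\<bar> \<le> a - t" and aa: "h - m \<le> a' - a" and tg: "p - lo \<le> g - t"
    using gap[of t a] gap[of a a'] gap[of t g] Q feasible_start[OF S] by auto
  have early: "t + ?l < a'" if "g \<le> a'"
  proof (cases "g \<le> a")
    case True
    then have "m - lo \<le> a - g" using gap[of g a] Q by auto
    then show ?thesis using aa tg less by linarith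
  next
    case False
    then have "m - lo \<le> g - a" using gap[of a g] Q by auto
    moreover have "h - lo \<le> a' - g" using gap[of g a'] Q that by auto
    moreover have "h + lo < 2 * m" using less by linarith
    ultimately show ?thesis using ta by linarith
  qed
  have late: "t + ?l \<le> g" if "a' \<le> g"
    using gap[of a' g] Q that ta aa by auto
  have "a' \<le> deliver S q" "g \<le> deliver S q"
    using last by (auto simp: abg)
  moreover have "deliver S q = g \<or> deliver S q = a'"
    using q by (auto simp: abg)
  moreover have "dst q = lo" if "deliver S q = g"
    using that feasible_request(5)[OF S q] Q(6) by simp
  ultimately show "t + ?l \<le> deliver S q \<and> (deliver S q = t + ?l \<longrightarrow> dst q = lo)"
    using early late by fastforce
qed auto

text \<open>With \<open>h \<le> p\<close> the comparison of orders reduces to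
  \<open>h + lo < 2 * m\<close>. Ending at \<open>h\<close> or \<open>k\<close> is then strictly
  longer than serving both transports in one sweep from \<open>m\<close> and finishing at
  \<open>lo\<close>.\<close>

lemma tour_transports_then_point:
  assumes c: "c \<noteq> 0" and A: "m < k" "k < h" "h \<le> p" and C: "lo < m" and less: "h + lo < 2 * m"
  shows "tour c p {Request m k r, Request k h r', Request lo lo r''}
    ((p - m) + (h - m) + (h - lo)) lo"
    (is "tour c p {?A, ?B, ?C} ?l lo")
proof (rule tourI[OF _ _ c])
  fix t assume rel: "\<forall>q\<in>{?A, ?B, ?C}. rel q \<le> t"
  define u where "u q = (if q = ?A then t + (p - m) else if q = ?B then t + (p - m) + (k - m)
    else t + ?l)" for q
  define d where "d q = (if q = ?A then t + (p - m) + (k - m) else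
    if q = ?B then t + (p - m) + (h - m) else t + ?l)" for q
  have ud: "u ?A = t + (p - m)" "u ?B = t + (p - m) + (k - m)" "u ?C = t + ?l"
    "d ?A = t + (p - m) + (k - m)" "d ?B = t + (p - m) + (h - m)" "d ?C = t + ?l"
    using A C by (auto simp: u_def d_def)
  have "\<exists>f. feasible_schedule c t p {?A, ?B, ?C} \<lparr>traj = f, pickup = u, deliver = d\<rparr>"
  proof (rule feasible_from_times)
    fix e v e' v'
    have ev: "(e, v) \<in> {(t, p), (t + (p - m), m), (t + (p - m) + (k - m), k),
        (t + (p - m) + (h - m), h), (t + ?l, lo)}"
      if "(e, v) \<in> events t p {?A, ?B, ?C} u d" for e v
      using that by (auto simp: events_def ud)
    assume "(e, v) \<in> events t p {?A, ?B, ?C} u d" "(e', v') \<in> events t p {?A, ?B, ?C} u d"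
    from ev[OF this(1)] ev[OF this(2)] show "\<bar>v - v'\<bar> \<le> \<bar>e - e'\<bar>"
      using A C by auto
  next
    fix s
    show "enat (card {q \<in> {?A, ?B, ?C}. u q \<le> s \<and> s < d q}) \<le> c"
      by (rule enat_card_le[OF c]) (use A C in \<open>auto simp: ud\<close>)
  qed (use rel A C in \<open>auto simp: ud\<close>)
  then obtain f where "feasible_schedule c t p {?A, ?B, ?C} \<lparr>traj = f, pickup = u, deliver = d\<rparr>" ..
  moreover have "\<forall>q\<in>{?A, ?B, ?C}. d q \<le> t + ?l" using A C by (auto simp: ud)
  ultimately show "\<exists>S. feasible_schedule c t p {?A, ?B, ?C} S \<and> (\<forall>q\<in>{?A, ?B, ?C}. deliver S q \<le> t + ?l)"
    by (intro exI[of _ "\<lparr>traj = f, pickup = u, deliver = d\<rparr>"]) simp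
next
  fix t S q
  assume S: "feasible_schedule c t p {?A, ?B, ?C} S" and q: "q \<in> {?A, ?B, ?C}"
    and last: "\<And>q'. q' \<in> {?A, ?B, ?C} \<Longrightarrow> deliver S q' \<le> deliver S q"
  define a a' b b' g where abg: "a = pickup S ?A" "a' = deliver S ?A" "b = pickup S ?B"
    "b' = deliver S ?B" "g = deliver S ?C"
  have Q: "t \<le> a" "a \<le> a'" "traj S a = m" "traj S a' = k"
      "t \<le> b" "b \<le> b'" "traj S b = k" "traj S b' = h" "t \<le> g" "traj S g = lo"
    using feasible_request[OF S, of ?A] feasible_request[OF S, of ?B] feasible_request[OF S, of ?C]
    by (auto simp: abg)
  have gap: "\<bar>traj S x - traj S y\<bar> \<le> y - x" if "t \<le> x" "x \<le> y" for x y
    using feasible_dist[OF S, of x y] that by simp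
  have ta: "p - m \<le> a - t" and aa: "k - m \<le> a' - a" and tb: "p - k \<le> b - t"
    and bb: "h - k \<le> b' - b" and tg: "p - lo \<le> g - t"
    using gap[of t a] gap[of a a'] gap[of t b] gap[of b b'] gap[of t g] Q feasible_start[OF S]
    by auto
  have first: "t + ?l < b'" if "g \<le> b'"
    using gap[of g b'] Q that tg less A by auto
  have second: "t + ?l < a'" if "b' \<le> g" "g \<le> a'"
  proof (cases "a \<le> b'")
    case True
    then have "h - m \<le> b' - a" using gap[of a b'] Q by auto
    moreover have "h - lo \<le> g - b'" "k - lo \<le> a' - g" using gap[of b' g] gap[of g a'] Q that by auto
    ultimately show ?thesis using ta A C by linarith
  next
    case False
    then have ab: "h - m \<le> a - b'" using gap[of b' a] Q by auto
    show ?thesis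
    proof (cases "g \<le> a")
      case True
      then have "h - lo \<le> g - b'" "m - lo \<le> a - g" using gap[of b' g] gap[of g a] Q that by auto
      then show ?thesis using tb bb aa A C less by linarith
    next
      case False
      then have "m - lo \<le> g - a" "k - lo \<le> a' - g" using gap[of a g] gap[of g a'] Q that by auto
      then show ?thesis using tb bb ab A C less by linarith
    qed
  qed
  \<comment> \<open>Doing \<open>?B\<close> before \<open>?A\<close> gives exactly the same length,
    so two orders tie here; both end at \<open>lo\<close>.\<close>
  have third: "t + ?l \<le> g" if "b' \<le> g" "a' \<le> g"
  proof (cases "a \<le> b'")
    case True
    then have "h - m \<le> b' - a" "h - lo \<le> g - b'" using gap[of a b'] gap[of b' g] Q that by auto
    then show ?thesis using ta by linarith
  next
    case False
    then have "h - m \<le> a - b'" "k - lo \<le> g - a'" using gap[of b' a] gap[of a' g] Q that by auto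
    then show ?thesis using tb bb aa by linarith
  qed
  have "a' \<le> deliver S q" "b' \<le> deliver S q" "g \<le> deliver S q"
    using last by (auto simp: abg)
  moreover have "deliver S q = g \<or> deliver S q = a' \<or> deliver S q = b'"
    using q by (auto simp: abg)
  moreover have "dst q = lo" if "deliver S q = g"
    using that feasible_request(5)[OF S q] Q(10) by simp
  ultimately show "t + ?l \<le> deliver S q \<and> (deliver S q = t + ?l \<longrightarrow> dst q = lo)"
    using first second third by fastforce
qed auto

section \<open>Bounds on the offline optimum\<close>

text \<open>A server that walks to \<open>- a\<close> and turns round passes position
  \<open>y\<close> at time \<open>2 * a + y\<close>, which is the bound imposed on the release
  times.\<close>

lemma Opt_dip_sweep_le:
  assumes fin: "finite \<sigma>" and ne: "\<sigma> \<noteq> {}" and c: "c \<noteq> 0" and a: "0 \<le> a"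
    and q: "\<And>q. q \<in> \<sigma> \<Longrightarrow> - a \<le> src q \<and> src q \<le> dst q \<and> rel q \<le> 2 * a + src q \<and> dst q \<le> hi"
    and no: "non_overlapping \<sigma>"
  shows "Opt c \<sigma> \<le> 2 * a + hi"
proof -
  obtain S where S: "feasible_schedule c 0 0 \<sigma> S" "\<forall>q\<in>\<sigma>. deliver S q = 2 * a + dst q"
    using feasible_dip_sweep[OF fin c, of "- a" 0 0] a q no by force
  obtain T where T: "shortest_schedule c 0 0 \<sigma> T" using shortest_schedule_exists[OF fin c] by blast
  have "Opt c \<sigma> = schedule_length 0 \<sigma> T" by (simp add: Opt_def L_eq_shortest[OF T])
  also have "\<dots> \<le> schedule_length 0 \<sigma> S" using T S(1) by (simp add: shortest_schedule_def)
  also have "\<dots> \<le> 2 * a + hi" using S(2) q fin ne by (simp add: schedule_length_def)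
  finally show ?thesis .
qed

text \<open>Nothing released after time 0 is delivered at time 0. This keeps the competitive ratio
  from being a division by zero.\<close>

lemma Opt_pos:
  assumes fin: "finite \<sigma>" and c: "c \<noteq> 0" and q: "q \<in> \<sigma>" "0 < rel q"
  shows "0 < Opt c \<sigma>"
proof -
  obtain T where T: "shortest_schedule c 0 0 \<sigma> T" using shortest_schedule_exists[OF fin c] by blast
  then have "feasible_schedule c 0 0 \<sigma> T" by (simp add: shortest_schedule_def)
  then have "0 < deliver T q" using feasible_request(2,3)[OF _ q(1)] q(2) by force
  also have "\<dots> \<le> Max (deliver T ` \<sigma>)" using fin q(1) by simp
  also have "\<dots> = Opt c \<sigma>"
    using q(1) by (auto simp: Opt_def L_eq_shortest[OF T] schedule_length_def)
  finally show ?thesis .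
qed


section \<open>Runs of Smartstart\<close>

text \<open>\<open>s\<close> meets the start condition and \<open>early\<close> rules out all
  earlier times, so \<open>s\<close> is the start time. The premise \<open>early\<close> refers to
  the set pending at \<open>t'\<close>, since that set may change during the wait.\<close>

lemma state_step:
  assumes tb: "tie_breaking c tb" and fin: "finite \<sigma>" and w: "w = 1 / (\<Theta> - 1)"
    and st: "smartstart_state tb c \<Theta> \<sigma> j = (t, p, Z)"
    and s: "t \<le> s" "pending \<sigma> Z s = R" "R \<noteq> {}" "l * w \<le> s" and tour: "tour c p R l x"
    and early: "\<And>t'. t \<le> t' \<Longrightarrow> t' < s \<Longrightarrow> pending \<sigma> Z t' \<noteq> {} \<Longrightarrow>
      t' < L c t' p (pending \<sigma> Z t') * w"
  shows "smartstart_state tb c \<Theta> \<sigma> (Suc j) = (s + l, x, Z \<union> R)"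
proof -
  have R: "finite R" "\<And>q. q \<in> R \<Longrightarrow> rel q \<le> s" using s(2) fin by (auto simp: pending_def)
  note tour = tourD[OF tour R(2)]
  have "start_time c \<Theta> \<sigma> Z t p = s"
    unfolding start_time_def
  proof (rule Least_equality)
    show "t \<le> s \<and> pending \<sigma> Z s \<noteq> {} \<and> L c s p (pending \<sigma> Z s) / (\<Theta> - 1) \<le> s"
      using s tour(1) w by simp
    show "s \<le> t'" if "t \<le> t' \<and> pending \<sigma> Z t' \<noteq> {} \<and> L c t' p (pending \<sigma> Z t') / (\<Theta> - 1) \<le> t'" for t'
      using early[of t'] that w by force
  qed
  moreover have S: "shortest_schedule c s p R (tb s p R)" using tb R(1) by (simp add: tie_breaking_def)
  moreover have "schedule_length s R (tb s p R) = l" using L_eq_shortest[OF S] tour(1) by simp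
  ultimately show ?thesis using st s(2) tour(2) by (simp add: Let_def)
qed

text \<open>With the pending set fixed during the wait, the threshold \<open>l * w\<close> is fixed
  too, and the server starts at the later of \<open>t\<close> and \<open>l * w\<close>.\<close>

lemma state_step_constant:
  assumes "tie_breaking c tb" "finite \<sigma>" "w = 1 / (\<Theta> - 1)"
    and "smartstart_state tb c \<Theta> \<sigma> j = (t, p, Z)" "R \<noteq> {}" "tour c p R l x" "s = max t (l * w)"
    and pend: "\<And>t'. t \<le> t' \<Longrightarrow> t' \<le> s \<Longrightarrow> pending \<sigma> Z t' = R"
  shows "smartstart_state tb c \<Theta> \<sigma> (Suc j) = (s + l, x, Z \<union> R)"
proof (rule state_step[OF assms(1-4)])
  fix t' assume t': "t \<le> t'" "t' < s"
  then have R: "pending \<sigma> Z t' = R" using pend by simp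
  then have "L c t' p R = l" using tourD(1)[OF assms(6), of t'] by (auto simp: pending_def)
  then show "t' < L c t' p (pending \<sigma> Z t') * w" using R t' assms(7) by auto
qed (use assms in auto)

text \<open>The served sets only grow along the run, so a request missing after \<open>N\<close>
  schedules makes \<open>Suc N\<close> the first index at which everything is served.\<close>

lemma Smartstart_eq:
  assumes "smartstart_state tb c \<Theta> \<sigma> N = (t, p, Z)" "q \<in> \<sigma>" "q \<notin> Z"
    and "smartstart_state tb c \<Theta> \<sigma> (Suc N) = (t', p', \<sigma>)"
  shows "Smartstart tb c \<Theta> \<sigma> = t'"
proof -
  define W where "W j = snd (snd (smartstart_state tb c \<Theta> \<sigma> j))" for j
  have step: "\<exists>t. W (Suc j) = W j \<union> pending \<sigma> (W j) t" for j
    by (auto simp: W_def Let_def split: prod.split)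
  have "W j \<subseteq> W (Suc j)" for j using step[of j] by auto
  then have mono: "i \<le> j \<Longrightarrow> W i \<subseteq> W j" for i j by (rule lift_Suc_mono_le)
  have "(LEAST j. W j = \<sigma>) = Suc N"
  proof (rule Least_equality)
    show "W (Suc N) = \<sigma>" using assms(4) unfolding W_def by simp
    show "Suc N \<le> j" if "W j = \<sigma>" for j
    proof (rule ccontr)
      assume "\<not> Suc N \<le> j"
      then have "\<sigma> \<subseteq> W N" using mono[of j N] that by simp
      then show False using assms(1-3) by (auto simp: W_def)
    qed
  qed
  then show ?thesis using assms(4) by (simp add: Smartstart_def W_def)
qed

declare smartstart_state.simps(2) [simp del]

text \<open>\<open>29377 / 10000\<close> is a rational just above \<open>rho_star\<close>, which
  turns all later comparisons into plain arithmetic.\<close>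

lemma rho_star_less_ratio:
  assumes "Opt c \<sigma> \<le> U" "0 < Opt c \<sigma>" "29377 / 10000 * U \<le> s"
  shows "rho_star < s / Opt c \<sigma>"
proof -
  have rho: "rho_star < 29377 / 10000"
    using abs_less_iff[THEN iffD1, OF rho_star_approx] by simp
  have "rho_star * Opt c \<sigma> < 29377 / 10000 * Opt c \<sigma>" using rho assms(2) by simp
  also have "\<dots> \<le> s" using assms(1,3) by linarith
  finally show ?thesis using assms(2) by (simp add: pos_less_divide_eq)
qed


section \<open>The interval from 1 to 2\<close>

text \<open>Points at \<open>x 1 < \<dots> < x n\<close> are released one after the other, followed at time \<open>T\<close> by a
  transport from \<open>-T\<close> to \<open>x n\<close>. Every schedule started before \<open>T\<close> moves right to the furthest
  point released so far.\<close>

locale staircase =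
  fixes c :: enat and tb :: "real \<Rightarrow> real \<Rightarrow> request set \<Rightarrow> schedule" and \<Theta> w :: real
    and x r :: "nat \<Rightarrow> real" and n :: nat
  assumes c: "c \<noteq> 0" and tb: "tie_breaking c tb" and \<Theta>: "1 < \<Theta>" and w: "w = 1 / (\<Theta> - 1)"
    and x0: "x 0 = 0" and x_mono: "i < j \<Longrightarrow> j \<le> n \<Longrightarrow> x i < x j"
    and r0: "0 \<le> r 0" and r_mono: "i \<le> j \<Longrightarrow> j \<le> Suc n \<Longrightarrow> r i \<le> r j" and T: "0 < r (Suc n)"
begin

abbreviation "T \<equiv> r (Suc n)"

definition pt :: "nat \<Rightarrow> request" where "pt i = Request (x i) (x i) (r i)"

definition last_request :: request where "last_request = Request (- T) (x n) T"

text \<open>Index 0 stands for the origin and contributes no request; hence the points are numbered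
  from 1.\<close>

definition requests :: "request set" where
  "requests = insert last_request (pt ` {1..n})"

abbreviation "state \<equiv> smartstart_state tb c \<Theta> requests"

text \<open>The number \<open>j\<close> of schedules is hidden because it varies with
  \<open>w\<close>: one schedule may serve several points.\<close>

definition reaches :: "nat \<Rightarrow> real \<Rightarrow> bool" where
  "reaches m t \<longleftrightarrow> m \<le> n \<and> (\<exists>j. state j = (t, x m, pt ` {1..m}))"

lemma finite_requests: "finite requests"
  by (simp add: requests_def)

lemma dial_a_ride_instance_requests: "dial_a_ride_instance requests"
proof -
  have "0 \<le> r i" if "i \<le> Suc n" for i using r_mono[of 0 i] r0 that by simp
  then show ?thesis
    using finite_requests
    by (auto simp: dial_a_ride_instance_def requests_def pt_def last_request_def)
qed

lemma x_mono': "i \<le> j \<Longrightarrow> j \<le> n \<Longrightarrow> x i \<le> x j"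
  using x_mono[of i j] by (cases "i = j") auto

lemma x_nonneg: "i \<le> n \<Longrightarrow> 0 \<le> x i"
  using x_mono'[of 0 i] x0 by simp

lemma pt_eq_iff: "i \<le> n \<Longrightarrow> j \<le> n \<Longrightarrow> pt i = pt j \<longleftrightarrow> i = j"
  using x_mono[of i j] x_mono[of j i] by (cases i j rule: linorder_cases) (auto simp: pt_def)

lemma last_request_notin:
  assumes "m \<le> n"
  shows "last_request \<notin> pt ` {1..m}"
proof
  assume "last_request \<in> pt ` {1..m}"
  then obtain i where "i \<le> m" "last_request = pt i" by auto
  then show False using x_nonneg[of i] T assms by (auto simp: pt_def last_request_def)
qed

lemma pending_requests:
  assumes "m \<le> n"
  shows "pending requests (pt ` {1..m}) t =
    (if T \<le> t then {last_request} else {}) \<union> pt ` {i. m < i \<and> i \<le> n \<and> r i \<le> t}"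
proof -
  have "inj_on pt {1..n}" by (auto simp: inj_on_def pt_eq_iff)
  then have "pt ` {1..n} - pt ` {1..m} = pt ` ({1..n} - {1..m})"
    using assms by (intro inj_on_image_set_diff[symmetric]) auto
  also have "{1..n} - {1..m} = {m<..n}" by auto
  finally have "requests - pt ` {1..m} = insert last_request (pt ` {m<..n})"
    using last_request_notin[OF assms] by (simp add: requests_def insert_Diff_if)
  moreover have "rel last_request = T" "rel (pt i) = r i" for i
    by (simp_all add: last_request_def pt_def)
  ultimately show ?thesis by (auto simp: pending_def)
qed

lemma tour_points:
  assumes "m < k" "k \<le> n"
  shows "tour c (x m) (pt ` {m<..k}) (x k - x m) (x k)"
proof (rule tour_sweep[where ?q0.0 = "pt k"])
  show "x m \<le> src q \<and> src q \<le> dst q \<and> dst q \<le> x k" if "q \<in> pt ` {m<..k}" for q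
    using that assms x_mono' by (auto simp: pt_def)
  show "non_overlapping (pt ` {m<..k})" by (rule non_overlapping_points) (auto simp: pt_def)
qed (use assms c in \<open>auto simp: pt_def\<close>)

text \<open>Releases are monotone, so before \<open>T\<close> the pending points form an interval of
  indices up to the furthest released \<open>k\<close>, and one walk to \<open>x k\<close> serves
  them all.\<close>

lemma frontier:
  assumes m: "m \<le> n" and t: "t < T" and ne: "pending requests (pt ` {1..m}) t \<noteq> {}"
  obtains k where "m < k" "k \<le> n" "r k \<le> t" "t < r (Suc k)"
    "pending requests (pt ` {1..m}) t = pt ` {m<..k}"
    "L c t (x m) (pending requests (pt ` {1..m}) t) = x k - x m"
proof -
  define K where "K = {i. m < i \<and> i \<le> n \<and> r i \<le> t}"
  define k where "k = Max K"
  have P: "pending requests (pt ` {1..m}) t = pt ` K"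
    using pending_requests[OF m] t by (simp add: K_def)
  have fin: "finite K" "K \<noteq> {}" using P ne by (auto simp: K_def)
  have k: "k \<in> K" using Max_in[OF fin] by (simp add: k_def)
  then have k': "m < k" "k \<le> n" "r k \<le> t" by (auto simp: K_def)
  have next_rel: "t < r (Suc k)"
  proof (cases "k = n")
    case False
    then have "Suc k \<notin> K" using Max_ge[OF fin(1), of "Suc k"] by (auto simp: k_def)
    then show ?thesis using False k' by (auto simp: K_def)
  qed (use t in simp)
  have "K = {m<..k}"
    using Max_ge[OF fin(1)] r_mono[of _ k] k' by (force simp: K_def k_def)
  then have "pending requests (pt ` {1..m}) t = pt ` {m<..k}" using P by simp
  moreover from this have "L c t (x m) (pending requests (pt ` {1..m}) t) = x k - x m"
    using tourD(1)[OF tour_points[OF k'(1,2)], of t] by (auto simp: pending_def)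
  ultimately show thesis using that k' next_rel by blast
qed

lemma reaches_0: "reaches 0 0"
  using x0 by (auto simp: reaches_def intro!: exI[of _ 0])

text \<open>While some \<open>i < k\<close> is the furthest released index, the threshold is
  \<open>(x i - x m) * w\<close>. The premise \<open>skip\<close> says that this phase is over at
  time \<open>t\<close>, or that the next release comes no later than the threshold. Thus the server
  does not start until \<open>k\<close> is the furthest index.\<close>

lemma reaches_step:
  assumes m: "reaches m t" and k: "m < k" "k \<le> n"
    and s: "s = max t (max (r k) ((x k - x m) * w))" "s < r (Suc k)"
    and skip: "\<And>i. m < i \<Longrightarrow> i < k \<Longrightarrow> r (Suc i) \<le> t \<or> r (Suc i) \<le> (x i - x m) * w"
  shows "reaches k (s + (x k - x m))"
proof -
  obtain j where j: "state j = (t, x m, pt ` {1..m})" using m by (auto simp: reaches_def)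
  have mn: "m \<le> n" using k by simp
  have sT: "s < T" using s(2) r_mono[of "Suc k" "Suc n"] k by simp
  have P: "pending requests (pt ` {1..m}) s = pt ` {m<..k}"
  proof -
    have "r i \<le> s \<longleftrightarrow> i \<le> k" if "i \<le> n" for i
      using that s k r_mono[of i k] r_mono[of "Suc k" i] by (cases "i \<le> k") auto
    then have "{i. m < i \<and> i \<le> n \<and> r i \<le> s} = {m<..k}" using k by auto
    then show ?thesis using pending_requests[OF mn, of s] sT by simp
  qed
  have "state (Suc j) = (s + (x k - x m), x k, pt ` {1..m} \<union> pt ` {m<..k})"
  proof (rule state_step[OF tb finite_requests w j _ P _ _ tour_points[OF k]])
    fix t' assume t': "t \<le> t'" "t' < s" "pending requests (pt ` {1..m}) t' \<noteq> {}"
    obtain i where i: "m < i" "i \<le> n" "r i \<le> t'" "t' < r (Suc i)"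
      "L c t' (x m) (pending requests (pt ` {1..m}) t') = x i - x m"
      using frontier[OF mn _ t'(3)] t'(2) sT by (metis less_trans)
    have "i \<le> k"
      using i(2,3) t'(2) s(2) r_mono[of "Suc k" i] by (cases "i \<le> k") auto
    then have "t' < (x i - x m) * w"
      using skip[OF i(1)] i(3,4) t' s(1) by (cases "i = k") auto
    then show "t' < L c t' (x m) (pending requests (pt ` {1..m}) t') * w" using i(5) by simp
  qed (use s k in auto)
  moreover have "{1..m} \<union> {m<..k} = {1..k}" using k by auto
  ultimately show ?thesis using k by (auto simp: reaches_def simp flip: image_Un)
qed

text \<open>The transport must be fetched at \<open>- T\<close> and carried to \<open>x n\<close>;
  the remaining points lie on its way and cost nothing.\<close>

lemma tour_last:
  assumes m: "m \<le> n"
  shows "tour c (x m) (insert last_request (pt ` {m<..n})) (x m + T + (x n + T)) (x n)"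
proof -
  have "tour c (x m) (insert last_request (pt ` {m<..n})) (x m - - T + (x n - - T)) (x n)"
  proof (rule tour_dip_sweep[where ?q0.0 = last_request])
    show "- T \<le> x m" using x_nonneg[OF m] T by simp
    show "- T \<le> src q \<and> src q \<le> dst q \<and> dst q \<le> x n"
      if "q \<in> insert last_request (pt ` {m<..n})" for q
      using that x_mono'[of _ n] x_nonneg T x_nonneg[of n]
      by (fastforce simp: pt_def last_request_def)
    show "non_overlapping (insert last_request (pt ` {m<..n}))"
      by (auto simp: non_overlapping_def pt_def)
  qed (use c in \<open>auto simp: last_request_def\<close>)
  then show ?thesis by (simp add: algebra_simps)
qed

text \<open>By \<open>skip\<close> no further schedule starts before \<open>T\<close>, so the
  transport and all points left form the final schedule. Its length \<open>l\<close> delays its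
  start to \<open>l * w\<close> or later, hence its end to \<open>(1 + w) * l\<close> or
  later.\<close>

lemma Smartstart_ge:
  assumes m: "reaches m t"
    and skip: "\<And>i. m < i \<Longrightarrow> i \<le> n \<Longrightarrow> r (Suc i) \<le> t \<or> r (Suc i) \<le> (x i - x m) * w"
  shows "(1 + w) * (x m + T + (x n + T)) \<le> Smartstart tb c \<Theta> requests"
proof -
  obtain j where mn: "m \<le> n" and j: "state j = (t, x m, pt ` {1..m})"
    using m by (auto simp: reaches_def)
  define l where "l = x m + T + (x n + T)"
  define s where "s = max (max t T) (l * w)"
  have P: "pending requests (pt ` {1..m}) t' = insert last_request (pt ` {m<..n})" if "T \<le> t'" for t'
  proof -
    have "r i \<le> t'" if "i \<le> n" for i using r_mono[of i "Suc n"] that \<open>T \<le> t'\<close> by simp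
    then have "{i. m < i \<and> i \<le> n \<and> r i \<le> t'} = {m<..n}" by auto
    then show ?thesis using pending_requests[OF mn, of t'] that by simp
  qed
  have "state (Suc j) = (s + l, x n, pt ` {1..m} \<union> insert last_request (pt ` {m<..n}))"
  proof (rule state_step[OF tb finite_requests w j _ P])
    show "tour c (x m) (insert last_request (pt ` {m<..n})) l (x n)"
      unfolding l_def by (rule tour_last[OF mn])
    fix t' assume t': "t \<le> t'" "t' < s" "pending requests (pt ` {1..m}) t' \<noteq> {}"
    show "t' < L c t' (x m) (pending requests (pt ` {1..m}) t') * w"
    proof (cases "T \<le> t'")
      case True
      then have "L c t' (x m) (pending requests (pt ` {1..m}) t') = l"
        using tourD(1)[OF tour_last[OF mn], of t'] P[OF True] unfolding l_def
        by (auto simp: pending_def)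
      then show ?thesis using True t' by (auto simp: s_def)
    next
      case False
      then obtain i where "m < i" "i \<le> n" "t' < r (Suc i)"
        "L c t' (x m) (pending requests (pt ` {1..m}) t') = x i - x m"
        using frontier[OF mn _ t'(3)] by (metis not_le)
      then show ?thesis using skip[of i] t'(1) by auto
    qed
  qed (auto simp: s_def)
  moreover have "{1..m} \<union> {m<..n} = {1..n}" using mn by auto
  ultimately have "state (Suc j) = (s + l, x n, requests)"
    by (auto simp: requests_def simp flip: image_Un)
  moreover note last_request_notin[OF mn]
  ultimately have "Smartstart tb c \<Theta> requests = s + l"
    using Smartstart_eq[OF j, of last_request] by (simp add: requests_def)
  moreover have "(1 + w) * l \<le> s + l" by (simp add: s_def algebra_simps)
  ultimately show ?thesis by (simp add: l_def)
qed

text \<open>Walking left from the start, the server reaches \<open>- T\<close> exactly at time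
  \<open>T\<close>, when the transport appears there.\<close>

lemma Opt_le:
  assumes "\<And>i. 1 \<le> i \<Longrightarrow> i \<le> n \<Longrightarrow> r i \<le> 2 * T + x i"
  shows "Opt c requests \<le> 2 * T + x n"
proof (rule Opt_dip_sweep_le[OF finite_requests _ c])
  show "- T \<le> src q \<and> src q \<le> dst q \<and> rel q \<le> 2 * T + src q \<and> dst q \<le> x n"
    if "q \<in> requests" for q
    using that assms x_mono'[of _ n] x_nonneg T x_nonneg[of n]
    by (fastforce simp: requests_def pt_def last_request_def)
  show "non_overlapping requests" by (auto simp: requests_def non_overlapping_def pt_def)
qed (use T in \<open>auto simp: requests_def\<close>)

end

text \<open>The numbers stem from a numerical search. They ensure that \<open>(1 + w) * (x m + 3850)\<close>, where \<open>x m\<close>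
  is the point to which the server has committed itself before time 1000, is large enough compared
  to the optimum 3850 simultaneously for all \<open>w \<ge> 1\<close>.\<close>

definition positions_I1 :: "nat \<Rightarrow> real" where
  "positions_I1 = nth [0, 40, 123, 276, 475, 884, 948, 1582, 1850]"

definition releases_I1 :: "nat \<Rightarrow> real" where
  "releases_I1 = nth [0, 0, 88, 173, 316, 455, 735, 935, 992, 1000]"

lemma staircase_I1:
  assumes "c \<noteq> 0" "tie_breaking c tb" "1 < \<Theta>"
  shows "staircase c tb \<Theta> (1 / (\<Theta> - 1)) positions_I1 releases_I1 8"
proof
  show "positions_I1 i < positions_I1 j" if "i < j" "j \<le> 8" for i j
    unfolding positions_I1_def by (rule sorted_wrt_nth_less[of "(<)"]) (use that in simp_all)
  show "releases_I1 i \<le> releases_I1 j" if "i \<le> j" "j \<le> Suc 8" for i j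
    unfolding releases_I1_def by (rule sorted_nth_mono) (use that in simp_all)
qed (use assms in \<open>simp_all add: positions_I1_def releases_I1_def\<close>)

text \<open>Only positions and releases enter, so the same set serves every \<open>\<Theta>\<close>,
  \<open>c\<close> and \<open>tb\<close>.\<close>

definition instance_I1 :: "request set" where
  "instance_I1 = staircase.requests positions_I1 releases_I1 8"

text \<open>The run is followed point by point, each split comparing a departure or arrival with a
  release time. A large \<open>w\<close> traps the server early, a small one lets it get far to the
  right; \<open>final\<close> balances \<open>1 + w\<close> against the position reached.\<close>

lemma rho_star_less_I1:
  assumes c: "c \<noteq> 0" and tb: "tie_breaking c tb" and \<Theta>: "1 < \<Theta>" "\<Theta> \<le> 2"
  shows "rho_star < Smartstart tb c \<Theta> instance_I1 / Opt c instance_I1"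
proof -
  define w where "w = 1 / (\<Theta> - 1)"
  have w_ge: "1 \<le> w" using \<Theta> by (simp add: w_def field_simps)
  interpret staircase c tb \<Theta> w positions_I1 releases_I1 8
    unfolding w_def using assms by (intro staircase_I1)
  note defs = positions_I1_def releases_I1_def
  \<comment> \<open>The premise \<open>skip\<close> becomes a \<open>list_all\<close> over explicit
    indices, so that it can be evaluated.\<close>
  have step: "reaches k t'"
    if "reaches m t" "m < k" "k \<le> 8" "t \<le> s" "releases_I1 k \<le> s"
      "(positions_I1 k - positions_I1 m) * w \<le> s"
      "s = t \<or> s = releases_I1 k \<or> s = (positions_I1 k - positions_I1 m) * w"
      "s < releases_I1 (Suc k)"
      "list_all (\<lambda>i. releases_I1 (Suc i) \<le> t \<or>
        releases_I1 (Suc i) \<le> (positions_I1 i - positions_I1 m) * w) [Suc m..<k]"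
      "t' = s + (positions_I1 k - positions_I1 m)"
    for m k t t' s
    using reaches_step[of m t k s] that by (auto simp: list_all_iff max_def)
  have final: ?thesis
    if m: "reaches m t" and ratio: "29377 / 10000 * 3850 \<le> (1 + w) * (positions_I1 m + 3850)"
      and skip: "list_all (\<lambda>i. releases_I1 (Suc i) \<le> t \<or>
        releases_I1 (Suc i) \<le> (positions_I1 i - positions_I1 m) * w) [Suc m..<9]"
    for m t
  proof -
    have "(1 + w) * (positions_I1 m + releases_I1 (Suc 8) + (positions_I1 8 + releases_I1 (Suc 8)))
        \<le> Smartstart tb c \<Theta> instance_I1"
      unfolding instance_I1_def
      by (rule Smartstart_ge[OF m]) (use skip in \<open>auto simp: list_all_iff\<close>)
    then have "(1 + w) * (positions_I1 m + 3850) \<le> Smartstart tb c \<Theta> instance_I1"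
      by (simp add: defs add.commute)
    moreover have "Opt c instance_I1 \<le> 3850"
    proof -
      have "releases_I1 i \<le> 2 * releases_I1 (Suc 8) + positions_I1 i" if "1 \<le> i" "i \<le> 8" for i
        using r_mono[of i "Suc 8"] that x_nonneg[of i] T by simp
      from Opt_le[OF this] show ?thesis by (simp add: instance_I1_def defs)
    qed
    moreover have "0 < Opt c instance_I1"
      unfolding instance_I1_def
      by (rule Opt_pos[OF finite_requests c, of last_request])
        (use T in \<open>auto simp: requests_def last_request_def\<close>)
    ultimately show ?thesis using ratio by (intro rho_star_less_ratio) auto
  qed
  show ?thesis
  \<comment> \<open>\<open>40 * (11 / 5) = 88\<close>: from this \<open>w\<close> on, the threshold
    for point 1 is not reached before point 2 is released. The same holds for the later points, and
    the server stays at the origin until \<open>T\<close>.\<close>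
  proof (cases "w < 11 / 5")
    case False
    show ?thesis
      by (rule final[OF reaches_0]) (use False in \<open>auto simp: defs upt_rec\<close>)
  next
    case w1: True
    have s1: "reaches 1 (40 * w + 40)"
      by (rule step[OF reaches_0, where s = "40 * w"]) (use w_ge w1 in \<open>auto simp: defs\<close>)
    show ?thesis
    \<comment> \<open>\<open>83 = 123 - 40\<close> is the next walk and 173 the release of point 3.
      The splits \<open>153 * w < 316\<close> and \<open>409 * w < 735\<close> below arise in the
      same way.\<close>
    proof (cases "83 * w < 173")
      case False
      show ?thesis
        by (rule final[OF s1]) (use False in \<open>auto simp: defs upt_rec\<close>)
    next
      case w2: True
      define s where "s = max 88 (83 * w)"
      have s: "88 \<le> s" "83 * w \<le> s" "s < 173" "s = 88 \<or> s = 83 * w" using w2 by (auto simp: s_def)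
      have s2: "reaches 2 (s + 83)"
        by (rule step[OF s1, where s = s]) (use w_ge s in \<open>auto simp: defs\<close>)
      show ?thesis
      proof (cases "153 * w < 316")
        case False
        show ?thesis
          by (rule final[OF s2]) (use False in \<open>auto simp: defs\<close>)
      next
        case w3: True
        define u where "u = max (s + 83) (max 173 (153 * w))"
        have u: "s + 83 \<le> u" "173 \<le> u" "153 * w \<le> u" "u < 316"
          "u = s + 83 \<or> u = 173 \<or> u = 153 * w"
          using s w3 by (auto simp: u_def)
        have s3: "reaches 3 (u + 153)"
          by (rule step[OF s2, where s = u]) (use u in \<open>auto simp: defs\<close>)
        show ?thesis
        proof (cases "u + 153 < 455")
          case False
          \<comment> \<open>Both \<open>s + 83\<close> and 173 are below 302, which leaves
            \<open>u = 153 * w\<close>.\<close>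
          then have wl: "19 / 10 < w" using u(5) s by auto
          show ?thesis
            by (rule final[OF s3]) (use wl False in \<open>auto simp: defs\<close>)
        next
          case u4: True
          have s4: "reaches 4 (u + 352)"
            by (rule step[OF s3, where s = "u + 153"]) (use u u4 in \<open>auto simp: defs\<close>)
          show ?thesis
          proof (cases "409 * w < 735")
            case False
            \<comment> \<open>Point 6 appears no later than the threshold for point 5, so the server
              walks \<open>473 = 948 - 475\<close> straight to point 6.\<close>
            have s6: "reaches 6 (473 * w + 473)"
              by (rule step[OF s4, where s = "473 * w"]) (use False u u4 in \<open>auto simp: defs\<close>)
            show ?thesis
              by (rule final[OF s6]) (use False in \<open>auto simp: defs\<close>)
          next
            case w5: True
            define v where "v = max (u + 352) (409 * w)"
            have v: "u + 352 \<le> v" "409 * w \<le> v" "v < 735" "v = u + 352 \<or> v = 409 * w"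
              using u u4 w5 by (auto simp: v_def)
            have s5: "reaches 5 (v + 409)"
              by (rule step[OF s4, where s = v]) (use u v in \<open>auto simp: defs\<close>)
            show ?thesis
            \<comment> \<open>\<open>526 = 935 - 409\<close>: the question is whether point 5 is
              reached before point 7 is released. Since \<open>525 \<le> v\<close>, the window is
              narrow and forces \<open>w\<close> close to 1.\<close>
            proof (cases "v < 526")
              case True
              then have wu: "83 * w < 91" using u v s by auto
              have s6: "reaches 6 (v + 473)"
                by (rule step[OF s5, where s = "v + 409"]) (use True u v wu in \<open>auto simp: defs\<close>)
              have s8: "reaches 8 (max (v + 473) (902 * w) + 902)"
                by (rule step[OF s6, where s = "max (v + 473) (902 * w)"])
                  (use True u v wu in \<open>auto simp: defs\<close>)
              \<comment> \<open>At \<open>w = 1\<close> only the last point is far enough: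
                \<open>2 * (1850 + 3850) / 3850\<close> is about 2.961.\<close>
              show ?thesis
                by (rule final[OF s8]) (use w_ge in \<open>auto simp: defs\<close>)
            next
              case False
              then have wl: "109 / 100 < w" using u(5) v(4) s(4) by auto
              show ?thesis
              \<comment> \<open>\<open>698 = 1582 - 884\<close> is the walk from point 5 to point 7,
                and 992 is the release of point 8. A server that has not left by then is trapped at
                point 5.\<close>
              proof (cases "v + 409 < 992 \<and> 698 * w < 992")
                case True
                have s7: "reaches 7 (max (v + 409) (698 * w) + 698)"
                  by (rule step[OF s5, where s = "max (v + 409) (698 * w)"])
                    (use True False in \<open>auto simp: defs\<close>)
                show ?thesis
                  by (rule final[OF s7]) (use False wl in \<open>auto simp: defs\<close>)
              next
                case late: False
                then have wl: "14 / 10 < w" using u(5) v(4) s(4) by auto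
                show ?thesis
                  by (rule final[OF s5]) (use wl late False in \<open>auto simp: defs\<close>)
              qed
            qed
          qed
        qed
      qed
    qed
  qed
qed


section \<open>The other intervals\<close>

text \<open>The first two requests make the server set out for 111 just before \<open>-65\<close>
  appears. The request at 286 released at time 100 makes it go right first and end at
  \<open>-65\<close>. The one released at 415 comes after that schedule has started, but before the
  optimum reaches 286 at time \<open>2 * 65 + 286 = 416\<close>.\<close>

definition instance_I2 :: "request set" where
  "instance_I2 = {Request 35 35 0, Request 111 111 58, Request (-65) (-65) 65,
     Request 286 286 100, Request 286 286 415}"

lemma rho_star_less_I2:
  assumes c: "c \<noteq> 0" and tb: "tie_breaking c tb"
    and \<Theta>: "(1 + sqrt 13) / 2 < \<Theta>" "\<Theta> \<le> 1 + sqrt 2"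
  shows "rho_star < Smartstart tb c \<Theta> instance_I2 / Opt c instance_I2"
proof -
  let ?P = "Request 35 35 0" and ?Q = "Request 111 111 58" and ?C = "Request (-65) (-65) 65"
    and ?D = "Request 286 286 100" and ?F = "Request 286 286 415"
  let ?st = "smartstart_state tb c \<Theta> instance_I2"
  define w where "w = 1 / (\<Theta> - 1)"
  have "3.6 < sqrt 13" by (rule real_less_rsqrt) (simp add: power2_eq_square)
  moreover have "sqrt 2 < 1.42" by (rule real_less_lsqrt) (simp_all add: power2_eq_square)
  \<comment> \<open>These bounds give \<open>58 < 35 * w + 35 < 65\<close> and
    \<open>526 * w < 415\<close>, which separates the release times from the start times.\<close>
  ultimately have wb: "0.7 < w" "w < 0.77" using \<Theta> by (simp_all add: w_def field_simps)
  have fin: "finite instance_I2" by (simp add: instance_I2_def)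
  have s0: "?st 0 = (0, 0, {})" by simp
  note step = state_step_constant[OF tb fin w_def]
  have s1: "?st (Suc 0) = (35 * w + 35, 35, {} \<union> {?P})"
  proof (rule step[OF s0])
    show "tour c 0 {?P} 35 35"
      using tour_sweep[OF _ c, of "{?P}" 0 35 ?P] by (simp add: non_overlapping_def)
  qed (use wb in \<open>auto simp: pending_def instance_I2_def\<close>)
  have s2: "?st (Suc (Suc 0)) = (35 * w + 35 + 76, 111, {} \<union> {?P} \<union> {?Q})"
  proof (rule step[OF s1])
    show "tour c 35 {?Q} 76 111"
      using tour_sweep[OF _ c, of "{?Q}" 35 111 ?Q] by (simp add: non_overlapping_def)
  qed (use wb in \<open>auto simp: pending_def instance_I2_def\<close>)
  have s3: "?st (Suc (Suc (Suc 0))) = (526 * w + 526, -65, {} \<union> {?P} \<union> {?Q} \<union> {?D, ?C})"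
  proof (rule step[OF s2])
    \<comment> \<open>Going right first is shorter by just 1: the other order takes
      \<open>176 + 351 = 527\<close>.\<close>
    show "tour c 111 {?D, ?C} 526 (-65)"
      using tour_transport_then_point[OF c, of 286 286 "-65" 111 100 65] by simp
  qed (use wb in \<open>auto simp: pending_def instance_I2_def\<close>)
  have s4: "?st (Suc (Suc (Suc (Suc 0)))) =
      (526 * w + 526 + 351, 286, {} \<union> {?P} \<union> {?Q} \<union> {?D, ?C} \<union> {?F})"
  proof (rule step[OF s3])
    show "tour c (-65) {?F} 351 286"
      using tour_sweep[OF _ c, of "{?F}" "-65" 286 ?F] by (simp add: non_overlapping_def)
  qed (use wb in \<open>auto simp: pending_def instance_I2_def\<close>)
  also have "{} \<union> {?P} \<union> {?Q} \<union> {?D, ?C} \<union> {?F} = instance_I2"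
    by (auto simp: instance_I2_def)
  finally have S: "Smartstart tb c \<Theta> instance_I2 = 526 * w + 526 + 351"
    by (intro Smartstart_eq[OF s3, of ?F]) (auto simp: instance_I2_def)
  have "Opt c instance_I2 \<le> 2 * 65 + 286"
    by (rule Opt_dip_sweep_le) (use c in \<open>auto simp: instance_I2_def non_overlapping_def\<close>)
  moreover have "0 < Opt c instance_I2"
    by (rule Opt_pos[where q = ?F]) (use c in \<open>auto simp: instance_I2_def\<close>)
  ultimately show ?thesis
    by (rule rho_star_less_ratio) (use S wb in simp)
qed

section \<open>The interval from \<open>1 + sqrt 2\<close> to 3\<close>

text \<open>The request from 1900 to 2200 is released so that the server takes it along on its way to 2200
  if and only if \<open>\<Theta>\<close> is small. For larger \<open>\<Theta>\<close> it lengthens the next schedule instead, which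
  compensates for the shorter wait.\<close>

definition instance_I3 :: "request set" where
  "instance_I3 = {Request 590 590 0, Request 2200 2200 500, Request (-1140) (-1140) 1140,
     Request 540 1900 1500, Request 1900 2200 1070, Request 2200 2200 4480}"

lemma rho_star_less_I3:
  assumes c: "c \<noteq> 0" and tb: "tie_breaking c tb" and \<Theta>: "1 + sqrt 2 < \<Theta>" "\<Theta> < 3"
  shows "rho_star < Smartstart tb c \<Theta> instance_I3 / Opt c instance_I3"
proof -
  let ?P = "Request 590 590 0" and ?D = "Request 2200 2200 500"
    and ?C = "Request (-1140) (-1140) 1140" and ?A = "Request 540 1900 1500"
    and ?B = "Request 1900 2200 1070" and ?F = "Request 2200 2200 4480"
  let ?st = "smartstart_state tb c \<Theta> instance_I3"
  define w where "w = 1 / (\<Theta> - 1)"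
  have "1.4142 < sqrt 2" by (rule real_less_rsqrt) (simp add: power2_eq_square)
  then have wb: "1 / 2 < w" "w < 0.7072" using \<Theta> by (simp_all add: w_def field_simps)
  have fin: "finite instance_I3" by (simp add: instance_I3_def)
  have s0: "?st 0 = (0, 0, {})" by simp
  note step = state_step_constant[OF tb fin w_def]
  have s1: "?st (Suc 0) = (590 * w + 590, 590, {} \<union> {?P})"
  proof (rule step[OF s0])
    show "tour c 0 {?P} 590 590"
      using tour_sweep[OF _ c, of "{?P}" 0 590 ?P] by (simp add: non_overlapping_def)
  qed (use wb in \<open>auto simp: pending_def instance_I3_def\<close>)
  have D: "tour c 590 {?D} 1610 2200"
    using tour_sweep[OF _ c, of "{?D}" 590 2200 ?D] by (simp add: non_overlapping_def)
  have F: "tour c (-1140) {?F} 3340 2200"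
    using tour_sweep[OF _ c, of "{?F}" "-1140" 2200 ?F] by (simp add: non_overlapping_def)
  have S: "29377 / 10000 * 4480 \<le> Smartstart tb c \<Theta> instance_I3"
  \<comment> \<open>\<open>1610 = 2200 - 590\<close> is the walk to 2200 and 1070 the release of
    \<open>?B\<close>: the split is whether the server has left before \<open>?B\<close>
    appears.\<close>
  proof (cases "1610 * w < 1070")
    case True
    define s where "s = max (590 * w + 590) (1610 * w)"
    have sb: "s < 1070" "590 * w + 590 \<le> s" "s \<le> 1610 * w \<or> s \<le> 590 * w + 590"
      using True wb by (auto simp: s_def)
    have s2: "?st (Suc (Suc 0)) = (s + 1610, 2200, {} \<union> {?P} \<union> {?D})"
    proof (rule step[OF s1])
      show "s = max (590 * w + 590) (1610 * w)" by (fact s_def)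
    qed (use wb sb D in \<open>auto simp: pending_def instance_I3_def\<close>)
    have s3: "?st (Suc (Suc (Suc 0))) =
        (6660 * w + 6660, -1140, {} \<union> {?P} \<union> {?D} \<union> {?A, ?B, ?C})"
    proof (rule step[OF s2])
      \<comment> \<open>540 exceeds 530, the midpoint of \<open>-1140\<close> and 2200, so both
        transports come before the point.\<close>
      show "tour c 2200 {?A, ?B, ?C} 6660 (-1140)"
        using tour_transports_then_point[OF c, of 540 1900 2200 2200 "-1140" 1500 1070 1140] by simp
    qed (use True wb sb in \<open>auto simp: pending_def instance_I3_def\<close>)
    have s4: "?st (Suc (Suc (Suc (Suc 0)))) =
        (6660 * w + 6660 + 3340, 2200, {} \<union> {?P} \<union> {?D} \<union> {?A, ?B, ?C} \<union> {?F})"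
      by (rule step[OF s3 _ F]) (use wb in \<open>auto simp: pending_def instance_I3_def\<close>)
    also have "{} \<union> {?P} \<union> {?D} \<union> {?A, ?B, ?C} \<union> {?F} = instance_I3"
      by (auto simp: instance_I3_def)
    finally have "Smartstart tb c \<Theta> instance_I3 = 6660 * w + 6660 + 3340"
      by (intro Smartstart_eq[OF s3, of ?F]) (auto simp: instance_I3_def)
    then show ?thesis using wb by simp
  next
    case False
    have s2: "?st (Suc (Suc 0)) = (1610 * w + 1610, 2200, {} \<union> {?P} \<union> {?D, ?B})"
    proof (rule state_step[OF tb fin w_def s1])
      have "tour c 590 {?D, ?B} (2200 - 590) 2200"
        by (rule tour_sweep[where ?q0.0 = ?D]) (use c in \<open>auto simp: non_overlapping_def\<close>)
      then show DB: "tour c 590 {?D, ?B} 1610 2200" by simp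
      fix t' assume t': "590 * w + 590 \<le> t'" "t' < 1610 * w"
      define R where "R = pending instance_I3 ({} \<union> {?P}) t'"
      \<comment> \<open>\<open>?B\<close> joins during the wait but lies on the way to 2200, so the
        length 1610 and the threshold do not change.\<close>
      have "R = (if t' < 1070 then {?D} else {?D, ?B})"
        using t' wb by (auto simp: R_def pending_def instance_I3_def)
      then have "tour c 590 R 1610 2200"
        using D DB by (simp split: if_splits)
      then have "L c t' 590 R = 1610" by (rule tourD(1)) (auto simp: R_def pending_def)
      then show "t' < L c t' 590 (pending instance_I3 ({} \<union> {?P}) t') * w"
        using t' by (simp add: R_def)
    qed (use False wb in \<open>auto simp: pending_def instance_I3_def\<close>)
    have s3: "?st (Suc (Suc (Suc 0))) =
        (6060 * w + 6060, -1140, {} \<union> {?P} \<union> {?D, ?B} \<union> {?A, ?C})"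
    proof (rule step[OF s2])
      show "tour c 2200 {?A, ?C} 6060 (-1140)"
        using tour_transport_then_point[OF c, of 540 1900 "-1140" 2200 1500 1140] by simp
    qed (use False wb in \<open>auto simp: pending_def instance_I3_def\<close>)
    have s4: "?st (Suc (Suc (Suc (Suc 0)))) =
        (6060 * w + 6060 + 3340, 2200, {} \<union> {?P} \<union> {?D, ?B} \<union> {?A, ?C} \<union> {?F})"
      by (rule step[OF s3 _ F]) (use wb in \<open>auto simp: pending_def instance_I3_def\<close>)
    also have "{} \<union> {?P} \<union> {?D, ?B} \<union> {?A, ?C} \<union> {?F} = instance_I3"
      by (auto simp: instance_I3_def)
    finally have "Smartstart tb c \<Theta> instance_I3 = 6060 * w + 6060 + 3340"
      by (intro Smartstart_eq[OF s3, of ?F]) (auto simp: instance_I3_def)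
    then show ?thesis using False by simp
  qed
  \<comment> \<open>\<open>?F\<close> is released exactly when the sweep arrives at 2200, at time
    4480.\<close>
  have "Opt c instance_I3 \<le> 2 * 1140 + 2200"
    by (rule Opt_dip_sweep_le) (use c in \<open>auto simp: instance_I3_def non_overlapping_def\<close>)
  moreover have "0 < Opt c instance_I3"
    by (rule Opt_pos[where q = ?F]) (use c in \<open>auto simp: instance_I3_def\<close>)
  ultimately show ?thesis
    by (rule rho_star_less_ratio) (use S in simp)
qed

section \<open>The parameters from 3 on\<close>

text \<open>For \<open>w \<le> 1 / 2\<close> no threshold delays the server:
  \<open>200 * w \<le> 100\<close>, \<open>591 * w < 300\<close> and \<open>301 * w < 891\<close>.
  It leaves at time 100, just before \<open>-101\<close> appears, and the run is the same for all
  these \<open>\<Theta>\<close>.\<close>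

definition instance_I4 :: "request set" where
  "instance_I4 = {Request 200 200 100, Request (-101) (-101) 101, Request 55 200 200,
     Request 200 200 400}"

lemma rho_star_less_I4:
  assumes c: "c \<noteq> 0" and tb: "tie_breaking c tb" and \<Theta>: "3 \<le> \<Theta>"
  shows "rho_star < Smartstart tb c \<Theta> instance_I4 / Opt c instance_I4"
proof -
  let ?D = "Request 200 200 100" and ?C = "Request (-101) (-101) 101"
    and ?A = "Request 55 200 200" and ?F = "Request 200 200 400"
  let ?st = "smartstart_state tb c \<Theta> instance_I4"
  define w where "w = 1 / (\<Theta> - 1)"
  have wb: "0 \<le> w" "w \<le> 1 / 2" using \<Theta> by (simp_all add: w_def field_simps)
  have fin: "finite instance_I4" by (simp add: instance_I4_def)
  have s0: "?st 0 = (0, 0, {})" by simp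
  note step = state_step_constant[OF tb fin w_def]
  have s1: "?st (Suc 0) = (100 + 200, 200, {} \<union> {?D})"
  proof (rule state_step[OF tb fin w_def s0])
    show "tour c 0 {?D} 200 200"
      using tour_sweep[OF _ c, of "{?D}" 0 200 ?D] by (simp add: non_overlapping_def)
  qed (use wb in \<open>auto simp: pending_def instance_I4_def\<close>)
  have s2: "?st (Suc (Suc 0)) = (300 + 591, -101, {} \<union> {?D} \<union> {?A, ?C})"
  proof (rule step[OF s1])
    show "tour c 200 {?A, ?C} 591 (-101)"
      using tour_transport_then_point[OF c, of 55 200 "-101" 200 200 101] by simp
  qed (use wb in \<open>auto simp: pending_def instance_I4_def\<close>)
  have s3: "?st (Suc (Suc (Suc 0))) = (300 + 591 + 301, 200, {} \<union> {?D} \<union> {?A, ?C} \<union> {?F})"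
  proof (rule step[OF s2])
    show "tour c (-101) {?F} 301 200"
      using tour_sweep[OF _ c, of "{?F}" "-101" 200 ?F] by (simp add: non_overlapping_def)
  qed (use wb in \<open>auto simp: pending_def instance_I4_def\<close>)
  also have "{} \<union> {?D} \<union> {?A, ?C} \<union> {?F} = instance_I4"
    by (auto simp: instance_I4_def)
  finally have S: "Smartstart tb c \<Theta> instance_I4 = 300 + 591 + 301"
    by (intro Smartstart_eq[OF s2, of ?F]) (auto simp: instance_I4_def)
  have "Opt c instance_I4 \<le> 2 * 101 + 200"
    by (rule Opt_dip_sweep_le) (use c in \<open>auto simp: instance_I4_def non_overlapping_def\<close>)
  moreover have "0 < Opt c instance_I4"
    by (rule Opt_pos[where q = ?F]) (use c in \<open>auto simp: instance_I4_def\<close>)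
  ultimately show ?thesis
    by (rule rho_star_less_ratio) (use S in simp)
qed

text \<open>The claim concerns positions and releases only, so any admissible parameters serve to
  interpret the locale.\<close>

lemma dial_a_ride_instance_I1: "dial_a_ride_instance instance_I1"
proof -
  obtain tb where "tie_breaking 1 tb" using tie_breaking_exists[of 1] by auto
  then interpret staircase 1 tb 2 "1 / (2 - 1)" positions_I1 releases_I1 8
    by (intro staircase_I1) auto
  show ?thesis unfolding instance_I1_def by (rule dial_a_ride_instance_requests)
qed

theorem lemma4p8:
  fixes c :: enat
  assumes "c \<noteq> 0"
  shows "\<forall>I \<in> {{1<..2},
               {(1 + sqrt 13) / 2 <.. 1 + sqrt 2},
               {1 + sqrt 2 <..< 3},
               {3..}}.
           \<exists>\<sigma>. dial_a_ride_instance \<sigma> \<and>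
             (\<forall>\<Theta>\<in>I. \<forall>tb. tie_breaking c tb \<longrightarrow>
                Smartstart tb c \<Theta> \<sigma> / Opt c \<sigma> > rho_star)"
proof -
  let ?P = "\<lambda>I \<sigma>. dial_a_ride_instance \<sigma> \<and>
    (\<forall>\<Theta>\<in>I. \<forall>tb. tie_breaking c tb \<longrightarrow> Smartstart tb c \<Theta> \<sigma> / Opt c \<sigma> > rho_star)"
  have "?P {1<..2} instance_I1"
    using dial_a_ride_instance_I1 rho_star_less_I1[OF assms] by simp
  moreover have "?P {(1 + sqrt 13) / 2 <.. 1 + sqrt 2} instance_I2"
    using rho_star_less_I2[OF assms] by (simp add: dial_a_ride_instance_def instance_I2_def)
  moreover have "?P {1 + sqrt 2 <..< 3} instance_I3"
    using rho_star_less_I3[OF assms] by (simp add: dial_a_ride_instance_def instance_I3_def)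
  moreover have "?P {3..} instance_I4"
    using rho_star_less_I4[OF assms] by (simp add: dial_a_ride_instance_def instance_I4_def)
  ultimately show ?thesis by blast
qed

end
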